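(* Let $\mathcal T=(\mathbb T,\mathcal V,\xi)$ be a topological theory with $\bot\neq k$ in $\mathcal V$ and $T1=1$. Let $X=(X,a)$ and $Y=(Y,b)$ be representable $\mathcal T$-categories. For a $\mathcal T$-functor $r:X\to VY$ let ${}_\llcorner r_\lrcorner:X\nrightarrow Y$ be the $\mathcal V$-relation ${}_\llcorner r_\lrcorner(x,y)=r(x)(y)$. Then $r\mapsto{}_\llcorner r_\lrcorner$ defines a bijection between the set $\mathcal T\text{-}\mathsf{ReprCat}(X,VY)$ of pseudo-homomorphisms $X\to VY$ and the set of all $\mathcal V$-distributors $\psi$ from $X_0=(X,a_0)$ to $Y_0=(Y,b_0)$ satisfying $$\psi\cdot a=b\cdot T_\xi\psi.$$
   Context: **Theory.** A topological theory $\mathcal T=(\mathbb T,\mathcal V,\xi)$ consists of a monad $\mathbb T=(T,e,m)$ on $\mathsf{Set}$, a commutative unital quantale $\mathcal V=(\mathcal V,\otimes,k)$ (complete lattice, commutative monoid, $\otimes$ preserves suprema in each variable; $x\otimes y\le z\iff x\le\hom(y,z)$) and a map $\xi:T\mathcal V\to\mathcal V$ such that (a) $T$ preserves weak pullbacks and every naturality square of $m$ is a weak pullback; (b) $(\mathcal V,\xi)$ is an Eilenberg–Moore $\mathbb T$-algebra, $\xi\cdot T(\otimes)=\otimes\cdot\langle\xi\cdot T\pi_1,\xi\cdot T\pi_2\rangle$ on $T(\mathcal V\times\mathcal V)$, and $\xi\cdot T(k)$ is constant $k$ on $T1$ (with $k:1\to\mathcal V$); (c) for every map $f:X\to Y$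 and $\varphi:X\to\mathcal V$, $\xi\cdot T(f_!\varphi)=(Tf)_!(\xi\cdot T\varphi)$, where $f_!\varphi(y)=\bigvee_{f(x)=y}\varphi(x)$. **Relations.** A $\mathcal V$-relation $r:X\nrightarrow Y$ is a map $X\times Y\to\mathcal V$, ordered pointwise; $(s\cdot r)(x,z)=\bigvee_y r(x,y)\otimes s(y,z)$; $r^\circ(y,x)=r(x,y)$; a map $f$ is identified with the relation with value $k$ if $f(x)=y$ and $\bot$ otherwise. $T_\xi r:TX\nrightarrow TY$ is $T_\xi r(\mathfrak x,\mathfrak y)=\bigvee\{\xi\cdot Tr(\mathfrak w)\mid \mathfrak w\in T(X\times Y),T\pi_1(\mathfrak w)=\mathfrak x,T\pi_2(\mathfrak w)=\mathfrak y\}$. **$\mathcal T$-categories.** A $\mathcal T$-category is $(X,a)$ with $a:TX\nrightarrow X$, $e_X^\circ\le a$ and $a\cdot T_\xi a\cdot m_X^\circ\le a$; a $\mathcal T$-functor $f:(X,a)\to(Y,b)$ is a map with $a(\mathfrak x,x)\le b(Tf(\mathfrak x),f(x))$. They form $\mathcal T\text{-}\mathsf{Cat}$. $a_0=a\cdot e_X$ makes $X_0=(X,a_0)$ a $\mathcal V$-category ($1_X\le a_0$, $a_0\cdot a_0\le a_0$). A $\mathcal V$-distributor from $(X,a_0)$ to $(Y,b_0)$ is a $\mathcal V$-relation $\psi:X\nrightarrow Y$ with $\psi\cdot a_0\le\psi$ and $b_0\cdot\psi\le\psi$. For maps into $(Y,b)$: $f\le g$ iff $k\le b_0(f(x),g(x))$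 for all $x$; $f\simeq g$ iff $f\le g$ and $g\le f$; $f\dashv g$ means $1\le gf$ and $fg\le 1$. **Representable.** $TX$ carries the $\mathcal T$-category structure $T_\xi a\cdot m_X^\circ\cdot m_X$; $X$ is representable if $e_X:X\to TX$ has a left adjoint $\alpha:TX\to X$ in $\mathcal T\text{-}\mathsf{Cat}$. A $\mathcal T$-functor $f$ between representable $\mathcal T$-categories (with left adjoints $\alpha,\beta$) is a pseudo-homomorphism if $\beta\cdot Tf\simeq f\cdot\alpha$. $\mathcal T\text{-}\mathsf{ReprCat}$: representable $\mathcal T$-categories and pseudo-homomorphisms. **$VY$.** $\mathcal V$ is a $\mathcal T$-category with structure $(\mathfrak v,v)\mapsto\hom(\xi(\mathfrak v),v)$. $\mathcal V^Y$ is the set of $\mathcal T$-functors $\varphi:Y\to\mathcal V$; $\mathrm{ev}:\mathcal V^Y\nrightarrow Y$, $\mathrm{ev}(\varphi,y)=\varphi(y)$; $\mu=b\cdot T_\xi\mathrm{ev}$. $VY$ is the $\mathcal T$-category on the set $\mathcal V^Y$ with structure $(\mathfrak p,\varphi)\mapsto\bigwedge_{y}\hom(\varphi(y),\mu(\mathfrak p,y))$; for $Y$ representable, $VY$ is separated and representable, the left adjoint of $e_{VY}$ being $\mathfrak p\mapsto\mu(\mathfrak p,-)$. *)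

theory Defs
  imports Complex_Main "HOL-Library.FuncSet" "HOL-Library.Nat_Bijection"
begin

section \<open>The category of sets\<close>

text \<open>
  A monad on Set cannot be a type constructor variable in HOL.  We therefore let Set be the
  category of small sets of an arbitrary universe: a type whose elements serve as the elements of
  sets, with \<open>small A\<close> saying that \<open>A\<close> is an object of Set and \<open>setcode A\<close> being the element
  that represents the small set \<open>A\<close>.  The closure conditions are the usual ones of a set universe
  (replacement is the special case \<open>F x = {f x}\<close> of \<open>small_UN\<close>).  Every Grothendieck universe is an
  instance, with \<open>setcode\<close> the identity.  An axiom of infinity is not imposed.
\<close>

class set_universe =
  fixes small :: "'a set \<Rightarrow> bool"
    and setcode :: "'a set \<Rightarrow> 'a"
  assumes small_empty: "small {}"
    and small_insert: "small A \<Longrightarrow> small (insert x A)"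
    and small_subset: "small A \<Longrightarrow> B \<subseteq> A \<Longrightarrow> small B"
    and small_UN: "small A \<Longrightarrow> (\<And>x. x \<in> A \<Longrightarrow> small (F x)) \<Longrightarrow> small (\<Union>x\<in>A. F x)"
    and small_Pow: "small A \<Longrightarrow> small (setcode ` Pow A)"
    and inj_setcode: "inj_on setcode (Collect small)"

text \<open>The hereditarily finite sets show that the axioms are satisfiable.\<close>

instantiation nat :: set_universe
begin

definition small_nat :: "nat set \<Rightarrow> bool" where "small_nat = finite"
definition setcode_nat :: "nat set \<Rightarrow> nat" where "setcode_nat = set_encode"

instance
proof
  show "inj_on (setcode :: nat set \<Rightarrow> nat) (Collect small)"
    unfolding small_nat_def setcode_nat_def by (rule inj_on_set_encode)
qed (auto simp: small_nat_def intro: finite_subset)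

end

text \<open>Kuratowski pairs; \<open>uprod X Y\<close> is the product in Set, with projections \<open>ufst\<close>, \<open>usnd\<close>.\<close>

definition upair :: "'u::set_universe \<Rightarrow> 'u \<Rightarrow> 'u" where
  "upair x y = setcode {setcode {x}, setcode {x, y}}"

definition uprod :: "'u::set_universe set \<Rightarrow> 'u set \<Rightarrow> 'u set" where
  "uprod X Y = {upair x y | x y. x \<in> X \<and> y \<in> Y}"

definition ufst :: "'u::set_universe \<Rightarrow> 'u" where
  "ufst p = (THE x. \<exists>y. p = upair x y)"

definition usnd :: "'u::set_universe \<Rightarrow> 'u" where
  "usnd p = (THE y. \<exists>x. p = upair x y)"

definition uone :: "'u::set_universe set" where
  "uone = {setcode {}}"

text \<open>\<open>fun_code Y f\<close> is the element representing the graph of \<open>f\<close> on \<open>Y\<close>; \<open>fun_app\<close> evaluates it.\<close>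

definition fun_code :: "'u::set_universe set \<Rightarrow> ('u \<Rightarrow> 'u) \<Rightarrow> 'u" where
  "fun_code Y f = setcode ((\<lambda>y. upair y (f y)) ` Y)"

definition fun_app :: "'u::set_universe \<Rightarrow> 'u \<Rightarrow> 'u" where
  "fun_app p y = (THE v. \<exists>A. small A \<and> p = setcode A \<and> upair y v \<in> A)"

lemma small_image:
  fixes f :: "'u::set_universe \<Rightarrow> 'u"
  assumes "small A" shows "small (f ` A)"
proof -
  have "f ` A = (\<Union>x\<in>A. {f x})" by auto
  then show ?thesis
    by (simp add: small_UN[OF assms] small_insert small_empty)
qed

lemma setcode_eq_iff: "small A \<Longrightarrow> small B \<Longrightarrow> setcode A = setcode B \<longleftrightarrow> A = B"
  using inj_setcode by (auto dest: inj_onD)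

lemma upair_eq_iff [simp]: "upair x y = upair x' y' \<longleftrightarrow> x = x' \<and> y = y'"
  by (auto simp: upair_def setcode_eq_iff small_insert small_empty doubleton_eq_iff)

lemma ufst_upair [simp]: "ufst (upair x y) = x"
  and usnd_upair [simp]: "usnd (upair x y) = y"
  by (auto simp: ufst_def usnd_def)

lemma small_uprod:
  assumes "small X" "small Y" shows "small (uprod X Y)"
proof -
  have "uprod X Y = (\<Union>x\<in>X. upair x ` Y)" by (auto simp: uprod_def)
  then show ?thesis using assms by (simp add: small_UN small_image)
qed

lemma fun_app_fun_code:
  assumes "small Y" "y \<in> Y" shows "fun_app (fun_code Y f) y = f y"
proof -
  have "small ((\<lambda>y. upair y (f y)) ` Y)" by (rule small_image[OF assms(1)])
  then show ?thesis using assms(2)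
    by (auto simp: fun_app_def fun_code_def setcode_eq_iff intro!: the_equality)
qed


section \<open>Quantales and relations\<close>

class comm_quantale = complete_lattice + comm_monoid_mult +
  assumes mult_Sup: "x * Sup A = (SUP y\<in>A. x * y)"

definition qhom :: "'v::comm_quantale \<Rightarrow> 'v \<Rightarrow> 'v" where
  "qhom y z = Sup {x. x * y \<le> z}"

lemma qhom_adjoint: "x * y \<le> z \<longleftrightarrow> x \<le> qhom y z" for x y z :: "'v::comm_quantale"
proof
  assume "x * y \<le> z" then show "x \<le> qhom y z" by (auto simp: qhom_def intro: Sup_upper)
next
  assume x: "x \<le> qhom y z"
  have "qhom y z * y = y * Sup {x. x * y \<le> z}" by (simp add: qhom_def mult.commute)
  also have "\<dots> \<le> z" by (auto simp: mult_Sup mult.commute intro: SUP_least)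
  finally have "qhom y z * y \<le> z" .
  moreover have "y * Sup {x, qhom y z} = sup (y * x) (y * qhom y z)" by (simp only: mult_Sup) simp
  then have "x * y \<le> qhom y z * y" using x by (simp add: sup_absorb2 le_iff_sup mult.commute)
  ultimately show "x * y \<le> z" by simp
qed

text \<open>
  Domain and codomain of a relation are given separately; only the values there matter.
  \<open>rcomp Y s r\<close> is \<open>s \<cdot> r\<close>, where \<open>Y\<close> is the codomain of \<open>r\<close>.
\<close>

type_synonym ('u, 'v) vrel = "'u \<times> 'u \<Rightarrow> 'v"

definition rel_le :: "'u set \<Rightarrow> 'u set \<Rightarrow> ('u, 'v::comm_quantale) vrel \<Rightarrow> ('u, 'v) vrel \<Rightarrow> bool" where
  "rel_le X Y r s \<longleftrightarrow> (\<forall>x\<in>X. \<forall>y\<in>Y. r (x, y) \<le> s (x, y))"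

definition rel_eq :: "'u set \<Rightarrow> 'u set \<Rightarrow> ('u, 'v::comm_quantale) vrel \<Rightarrow> ('u, 'v) vrel \<Rightarrow> bool" where
  "rel_eq X Y r s \<longleftrightarrow> (\<forall>x\<in>X. \<forall>y\<in>Y. r (x, y) = s (x, y))"

definition rcomp :: "'u set \<Rightarrow> ('u, 'v::comm_quantale) vrel \<Rightarrow> ('u, 'v) vrel \<Rightarrow> ('u, 'v) vrel" where
  "rcomp Y s r = (\<lambda>(x, z). SUP y\<in>Y. r (x, y) * s (y, z))"

definition rconv :: "('u, 'v) vrel \<Rightarrow> ('u, 'v) vrel" where
  "rconv r = (\<lambda>(y, x). r (x, y))"

definition rgraph :: "('u \<Rightarrow> 'u) \<Rightarrow> ('u, 'v::comm_quantale) vrel" where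
  "rgraph f = (\<lambda>(x, y). if f x = y then 1 else bot)"

definition push :: "'u set \<Rightarrow> ('u \<Rightarrow> 'u) \<Rightarrow> ('u \<Rightarrow> 'v::comm_quantale) \<Rightarrow> 'u \<Rightarrow> 'v" where
  "push X f \<phi> y = (SUP x\<in>{x\<in>X. f x = y}. \<phi> x)"


section \<open>Topological theories\<close>

text \<open>
  \<open>Tmap X Y f\<close> is \<open>T f : T X \<rightarrow> T Y\<close> for a map \<open>f : X \<rightarrow> Y\<close> of small sets.
  The quantale is a type; \<open>Venc\<close> embeds it into the universe so that it becomes an object of Set.
\<close>

record ('u, 'v) top_theory =
  Tob :: "'u set \<Rightarrow> 'u set"
  Tmap :: "'u set \<Rightarrow> 'u set \<Rightarrow> ('u \<Rightarrow> 'u) \<Rightarrow> 'u \<Rightarrow> 'u"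
  Tunit :: "'u set \<Rightarrow> 'u \<Rightarrow> 'u"
  Tmult :: "'u set \<Rightarrow> 'u \<Rightarrow> 'u"
  Venc :: "'v \<Rightarrow> 'u"
  xi :: "'u \<Rightarrow> 'v"

definition Vob :: "('u, 'v) top_theory \<Rightarrow> 'u set" where
  "Vob \<T> = range (Venc \<T>)"

definition Vdec :: "('u, 'v) top_theory \<Rightarrow> 'u \<Rightarrow> 'v" where
  "Vdec \<T> = inv (Venc \<T>)"

text \<open>
  A morphism \<open>X \<rightarrow> Y\<close> of Set is a HOL function considered on \<open>X\<close> only, so the functor has to respect
  equality on \<open>X\<close>.
\<close>

definition set_functor :: "('u::set_universe, 'v) top_theory \<Rightarrow> bool" where
  "set_functor \<T> \<longleftrightarrow>
     (\<forall>X. small X \<longrightarrow> small (Tob \<T> X)) \<and>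
     (\<forall>X Y f. small X \<and> small Y \<and> f \<in> X \<rightarrow> Y \<longrightarrow> Tmap \<T> X Y f \<in> Tob \<T> X \<rightarrow> Tob \<T> Y) \<and>
     (\<forall>X Y f g. small X \<and> small Y \<and> f \<in> X \<rightarrow> Y \<and> g \<in> X \<rightarrow> Y \<and> (\<forall>x\<in>X. f x = g x) \<longrightarrow>
        (\<forall>\<xx>\<in>Tob \<T> X. Tmap \<T> X Y f \<xx> = Tmap \<T> X Y g \<xx>)) \<and>
     (\<forall>X. small X \<longrightarrow> (\<forall>\<xx>\<in>Tob \<T> X. Tmap \<T> X X (\<lambda>x. x) \<xx> = \<xx>)) \<and>
     (\<forall>X Y Z f g. small X \<and> small Y \<and> small Z \<and> f \<in> X \<rightarrow> Y \<and> g \<in> Y \<rightarrow> Z \<longrightarrow>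
        (\<forall>\<xx>\<in>Tob \<T> X. Tmap \<T> X Z (g \<circ> f) \<xx> = Tmap \<T> Y Z g (Tmap \<T> X Y f \<xx>)))"

definition set_monad :: "('u::set_universe, 'v) top_theory \<Rightarrow> bool" where
  "set_monad \<T> \<longleftrightarrow>
     set_functor \<T> \<and>
     (\<forall>X. small X \<longrightarrow> Tunit \<T> X \<in> X \<rightarrow> Tob \<T> X) \<and>
     (\<forall>X. small X \<longrightarrow> Tmult \<T> X \<in> Tob \<T> (Tob \<T> X) \<rightarrow> Tob \<T> X) \<and>
     (\<forall>X Y f. small X \<and> small Y \<and> f \<in> X \<rightarrow> Y \<longrightarrow>
        (\<forall>x\<in>X. Tmap \<T> X Y f (Tunit \<T> X x) = Tunit \<T> Y (f x)) \<and>
        (\<forall>\<XX>\<in>Tob \<T> (Tob \<T> X). Tmap \<T> X Y f (Tmult \<T> X \<XX>)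
            = Tmult \<T> Y (Tmap \<T> (Tob \<T> X) (Tob \<T> Y) (Tmap \<T> X Y f) \<XX>))) \<and>
     (\<forall>X. small X \<longrightarrow>
        (\<forall>\<xx>\<in>Tob \<T> X. Tmult \<T> X (Tunit \<T> (Tob \<T> X) \<xx>) = \<xx>) \<and>
        (\<forall>\<xx>\<in>Tob \<T> X. Tmult \<T> X (Tmap \<T> X (Tob \<T> X) (Tunit \<T> X) \<xx>) = \<xx>) \<and>
        (\<forall>\<XX>\<in>Tob \<T> (Tob \<T> (Tob \<T> X)).
            Tmult \<T> X (Tmult \<T> (Tob \<T> X) \<XX>)
          = Tmult \<T> X (Tmap \<T> (Tob \<T> (Tob \<T> X)) (Tob \<T> X) (Tmult \<T> X) \<XX>)))"

text \<open>\<open>P\<close> with \<open>p : P \<rightarrow> A\<close>, \<open>q : P \<rightarrow> B\<close> is a weak pullback of \<open>f : A \<rightarrow> C\<close> and \<open>g : B \<rightarrow> C\<close>.\<close>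

definition weak_pullback ::
  "'u::set_universe set \<Rightarrow> 'u set \<Rightarrow> 'u set \<Rightarrow> 'u set \<Rightarrow>
   ('u \<Rightarrow> 'u) \<Rightarrow> ('u \<Rightarrow> 'u) \<Rightarrow> ('u \<Rightarrow> 'u) \<Rightarrow> ('u \<Rightarrow> 'u) \<Rightarrow> bool" where
  "weak_pullback P A B C p q f g \<longleftrightarrow>
     p \<in> P \<rightarrow> A \<and> q \<in> P \<rightarrow> B \<and> f \<in> A \<rightarrow> C \<and> g \<in> B \<rightarrow> C \<and>
     (\<forall>w\<in>P. f (p w) = g (q w)) \<and>
     (\<forall>(Q::'u set) h l. small Q \<and> h \<in> Q \<rightarrow> A \<and> l \<in> Q \<rightarrow> B \<and> (\<forall>z\<in>Q. f (h z) = g (l z)) \<longrightarrow>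
        (\<exists>u \<in> Q \<rightarrow> P. \<forall>z\<in>Q. p (u z) = h z \<and> q (u z) = l z))"

text \<open>\<open>xiT \<T> X \<phi>\<close> is \<open>\<xi> \<cdot> T \<phi> : T X \<rightarrow> V\<close> for a map \<open>\<phi> : X \<rightarrow> V\<close>.\<close>

definition xiT :: "('u, 'v) top_theory \<Rightarrow> 'u set \<Rightarrow> ('u \<Rightarrow> 'v) \<Rightarrow> 'u \<Rightarrow> 'v" where
  "xiT \<T> X \<phi> \<xx> = xi \<T> (Tmap \<T> X (Vob \<T>) (Venc \<T> \<circ> \<phi>) \<xx>)"

definition topological_theory :: "('u::set_universe, 'v::comm_quantale) top_theory \<Rightarrow> bool" where
  "topological_theory \<T> \<longleftrightarrow>
     set_monad \<T> \<and> inj (Venc \<T>) \<and> small (Vob \<T>) \<and>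
     \<comment> \<open>(a)\<close>
     (\<forall>P A B C p q f g.
        small P \<and> small A \<and> small B \<and> small C \<and> weak_pullback P A B C p q f g \<longrightarrow>
        weak_pullback (Tob \<T> P) (Tob \<T> A) (Tob \<T> B) (Tob \<T> C)
          (Tmap \<T> P A p) (Tmap \<T> P B q) (Tmap \<T> A C f) (Tmap \<T> B C g)) \<and>
     (\<forall>X Y f. small X \<and> small Y \<and> f \<in> X \<rightarrow> Y \<longrightarrow>
        weak_pullback (Tob \<T> (Tob \<T> X)) (Tob \<T> (Tob \<T> Y)) (Tob \<T> X) (Tob \<T> Y)
          (Tmap \<T> (Tob \<T> X) (Tob \<T> Y) (Tmap \<T> X Y f)) (Tmult \<T> X)
          (Tmult \<T> Y) (Tmap \<T> X Y f)) \<and>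
     \<comment> \<open>(b)\<close>
     (\<forall>v. xi \<T> (Tunit \<T> (Vob \<T>) (Venc \<T> v)) = v) \<and>
     (\<forall>\<WW>\<in>Tob \<T> (Tob \<T> (Vob \<T>)).
        xi \<T> (Tmult \<T> (Vob \<T>) \<WW>) = xiT \<T> (Tob \<T> (Vob \<T>)) (xi \<T>) \<WW>) \<and>
     (\<forall>\<ww>\<in>Tob \<T> (uprod (Vob \<T>) (Vob \<T>)).
        xiT \<T> (uprod (Vob \<T>) (Vob \<T>)) (\<lambda>p. Vdec \<T> (ufst p) * Vdec \<T> (usnd p)) \<ww>
        = xi \<T> (Tmap \<T> (uprod (Vob \<T>) (Vob \<T>)) (Vob \<T>) ufst \<ww>)
        * xi \<T> (Tmap \<T> (uprod (Vob \<T>) (Vob \<T>)) (Vob \<T>) usnd \<ww>)) \<and>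
     (\<forall>\<tt>\<in>Tob \<T> uone. xiT \<T> uone (\<lambda>_. 1) \<tt> = 1) \<and>
     \<comment> \<open>(c)\<close>
     (\<forall>X Y f \<phi>. small X \<and> small Y \<and> f \<in> X \<rightarrow> Y \<longrightarrow>
        (\<forall>\<yy>\<in>Tob \<T> Y. xiT \<T> Y (push X f \<phi>) \<yy> = push (Tob \<T> X) (Tmap \<T> X Y f) (xiT \<T> X \<phi>) \<yy>))"

definition Txi :: "('u::set_universe, 'v::comm_quantale) top_theory \<Rightarrow> 'u set \<Rightarrow> 'u set \<Rightarrow>
    ('u, 'v) vrel \<Rightarrow> ('u, 'v) vrel" where
  "Txi \<T> X Y r = (\<lambda>(\<xx>, \<yy>). Sup {xiT \<T> (uprod X Y) (\<lambda>p. r (ufst p, usnd p)) \<ww> | \<ww>.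
      \<ww> \<in> Tob \<T> (uprod X Y) \<and>
      Tmap \<T> (uprod X Y) X ufst \<ww> = \<xx> \<and> Tmap \<T> (uprod X Y) Y usnd \<ww> = \<yy>})"


section \<open>Categories over a topological theory\<close>

definition tcat :: "('u::set_universe, 'v::comm_quantale) top_theory \<Rightarrow> 'u set \<Rightarrow> ('u, 'v) vrel \<Rightarrow> bool" where
  "tcat \<T> X a \<longleftrightarrow> small X \<and>
     rel_le (Tob \<T> X) X (rconv (rgraph (Tunit \<T> X))) a \<and>
     rel_le (Tob \<T> X) X
       (rcomp (Tob \<T> X) a (rcomp (Tob \<T> (Tob \<T> X)) (Txi \<T> (Tob \<T> X) X a) (rconv (rgraph (Tmult \<T> X))))) a"

definition tfunctor :: "('u::set_universe, 'v::comm_quantale) top_theory \<Rightarrow>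
    'u set \<Rightarrow> ('u, 'v) vrel \<Rightarrow> 'u set \<Rightarrow> ('u, 'v) vrel \<Rightarrow> ('u \<Rightarrow> 'u) \<Rightarrow> bool" where
  "tfunctor \<T> X a Y b f \<longleftrightarrow> f \<in> X \<rightarrow> Y \<and>
     (\<forall>\<xx>\<in>Tob \<T> X. \<forall>x\<in>X. a (\<xx>, x) \<le> b (Tmap \<T> X Y f \<xx>, f x))"

text \<open>The relation \<open>a\<^sub>0 = a \<cdot> e\<^sub>X\<close>.\<close>

definition under0 :: "('u::set_universe, 'v::comm_quantale) top_theory \<Rightarrow> 'u set \<Rightarrow> ('u, 'v) vrel \<Rightarrow> ('u, 'v) vrel" where
  "under0 \<T> X a = rcomp (Tob \<T> X) a (rgraph (Tunit \<T> X))"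

text \<open>\<open>f \<le> g\<close> and \<open>f \<simeq> g\<close> for maps from \<open>X\<close> into \<open>(Y, b)\<close>.\<close>

definition map_le :: "('u::set_universe, 'v::comm_quantale) top_theory \<Rightarrow> 'u set \<Rightarrow>
    'u set \<Rightarrow> ('u, 'v) vrel \<Rightarrow> ('u \<Rightarrow> 'u) \<Rightarrow> ('u \<Rightarrow> 'u) \<Rightarrow> bool" where
  "map_le \<T> X Y b f g \<longleftrightarrow> (\<forall>x\<in>X. 1 \<le> under0 \<T> Y b (f x, g x))"

definition map_equiv :: "('u::set_universe, 'v::comm_quantale) top_theory \<Rightarrow> 'u set \<Rightarrow>
    'u set \<Rightarrow> ('u, 'v) vrel \<Rightarrow> ('u \<Rightarrow> 'u) \<Rightarrow> ('u \<Rightarrow> 'u) \<Rightarrow> bool" where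
  "map_equiv \<T> X Y b f g \<longleftrightarrow> map_le \<T> X Y b f g \<and> map_le \<T> X Y b g f"

definition adjunction :: "('u::set_universe, 'v::comm_quantale) top_theory \<Rightarrow>
    'u set \<Rightarrow> ('u, 'v) vrel \<Rightarrow> 'u set \<Rightarrow> ('u, 'v) vrel \<Rightarrow> ('u \<Rightarrow> 'u) \<Rightarrow> ('u \<Rightarrow> 'u) \<Rightarrow> bool" where
  "adjunction \<T> X a Y b f g \<longleftrightarrow>
     tfunctor \<T> X a Y b f \<and> tfunctor \<T> Y b X a g \<and>
     map_le \<T> X X a (\<lambda>x. x) (g \<circ> f) \<and> map_le \<T> Y Y b (f \<circ> g) (\<lambda>y. y)"

text \<open>The structure \<open>T\<^sub>\<xi> a \<cdot> m\<^sub>X\<^sup>\<circ> \<cdot> m\<^sub>X\<close> on \<open>T X\<close>.\<close>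

definition Tstruct :: "('u::set_universe, 'v::comm_quantale) top_theory \<Rightarrow> 'u set \<Rightarrow> ('u, 'v) vrel \<Rightarrow> ('u, 'v) vrel" where
  "Tstruct \<T> X a =
     rcomp (Tob \<T> (Tob \<T> X)) (Txi \<T> (Tob \<T> X) X a)
       (rcomp (Tob \<T> X) (rconv (rgraph (Tmult \<T> X))) (rgraph (Tmult \<T> X)))"

definition unit_left_adjoint :: "('u::set_universe, 'v::comm_quantale) top_theory \<Rightarrow>
    'u set \<Rightarrow> ('u, 'v) vrel \<Rightarrow> ('u \<Rightarrow> 'u) \<Rightarrow> bool" where
  "unit_left_adjoint \<T> X a \<alpha> \<longleftrightarrow>
     adjunction \<T> (Tob \<T> X) (Tstruct \<T> X a) X a \<alpha> (Tunit \<T> X)"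

definition representable :: "('u::set_universe, 'v::comm_quantale) top_theory \<Rightarrow> 'u set \<Rightarrow> ('u, 'v) vrel \<Rightarrow> bool" where
  "representable \<T> X a \<longleftrightarrow> tcat \<T> X a \<and> (\<exists>\<alpha>. unit_left_adjoint \<T> X a \<alpha>)"

text \<open>Left adjoints are unique up to \<open>\<simeq>\<close>, so the condition does not depend on the choice of \<open>\<alpha>\<close> and \<open>\<beta>\<close>.\<close>

definition pseudo_hom :: "('u::set_universe, 'v::comm_quantale) top_theory \<Rightarrow>
    'u set \<Rightarrow> ('u, 'v) vrel \<Rightarrow> 'u set \<Rightarrow> ('u, 'v) vrel \<Rightarrow> ('u \<Rightarrow> 'u) \<Rightarrow> bool" where
  "pseudo_hom \<T> X a Y b f \<longleftrightarrow>
     tfunctor \<T> X a Y b f \<and>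
     (\<exists>\<alpha> \<beta>. unit_left_adjoint \<T> X a \<alpha> \<and> unit_left_adjoint \<T> Y b \<beta> \<and>
        map_equiv \<T> (Tob \<T> X) Y b (\<beta> \<circ> Tmap \<T> X Y f) (f \<circ> \<alpha>))"

text \<open>
  In a set of maps or relations, the arguments outside the domain are fixed to \<open>undefined\<close>
  (as in \<open>\<rightarrow>\<^sub>E\<close>), so that equality is equality on the domain.
\<close>

definition reprcat_hom :: "('u::set_universe, 'v::comm_quantale) top_theory \<Rightarrow>
    'u set \<Rightarrow> ('u, 'v) vrel \<Rightarrow> 'u set \<Rightarrow> ('u, 'v) vrel \<Rightarrow> ('u \<Rightarrow> 'u) set" where
  "reprcat_hom \<T> X a Y b =
     {f \<in> X \<rightarrow>\<^sub>E Y. representable \<T> X a \<and> representable \<T> Y b \<and> pseudo_hom \<T> X a Y b f}"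

definition vdistributors :: "'u set \<Rightarrow> ('u, 'v::comm_quantale) vrel \<Rightarrow> 'u set \<Rightarrow> ('u, 'v) vrel \<Rightarrow> ('u, 'v) vrel set" where
  "vdistributors X a0 Y b0 =
     {\<psi> \<in> X \<times> Y \<rightarrow>\<^sub>E UNIV. rel_le X Y (rcomp X \<psi> a0) \<psi> \<and> rel_le X Y (rcomp Y b0 \<psi>) \<psi>}"


section \<open>The object \<open>VY\<close>\<close>

definition Vstruct :: "('u, 'v::comm_quantale) top_theory \<Rightarrow> ('u, 'v) vrel" where
  "Vstruct \<T> = (\<lambda>(\<vv>, v). qhom (xi \<T> \<vv>) (Vdec \<T> v))"

definition VY_set :: "('u::set_universe, 'v::comm_quantale) top_theory \<Rightarrow> 'u set \<Rightarrow> ('u, 'v) vrel \<Rightarrow> 'u set" where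
  "VY_set \<T> Y b = {fun_code Y \<phi> | \<phi>. tfunctor \<T> Y b (Vob \<T>) (Vstruct \<T>) \<phi>}"

definition VY_ev :: "('u::set_universe, 'v::comm_quantale) top_theory \<Rightarrow> ('u, 'v) vrel" where
  "VY_ev \<T> = (\<lambda>(\<phi>, y). Vdec \<T> (fun_app \<phi> y))"

definition VY_mu :: "('u::set_universe, 'v::comm_quantale) top_theory \<Rightarrow> 'u set \<Rightarrow> ('u, 'v) vrel \<Rightarrow> ('u, 'v) vrel" where
  "VY_mu \<T> Y b = rcomp (Tob \<T> Y) b (Txi \<T> (VY_set \<T> Y b) Y (VY_ev \<T>))"

definition VY_struct :: "('u::set_universe, 'v::comm_quantale) top_theory \<Rightarrow> 'u set \<Rightarrow> ('u, 'v) vrel \<Rightarrow> ('u, 'v) vrel" where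
  "VY_struct \<T> Y b = (\<lambda>(\<pp>, \<phi>). INF y\<in>Y. qhom (VY_ev \<T> (\<phi>, y)) (VY_mu \<T> Y b (\<pp>, y)))"

text \<open>The relation \<open>(x, y) \<mapsto> r(x)(y)\<close>.\<close>

definition lower :: "('u::set_universe, 'v::comm_quantale) top_theory \<Rightarrow> 'u set \<Rightarrow> 'u set \<Rightarrow> ('u \<Rightarrow> 'u) \<Rightarrow> ('u, 'v) vrel" where
  "lower \<T> X Y r = (\<lambda>(x, y)\<in>X \<times> Y. VY_ev \<T> (r x, y))"

end

theory Submission
  imports Defs
begin

text \<open>
  A map \<open>r\<close> into \<open>VY\<close> is the same as a relation \<open>\<psi> = ev \<cdot> r\<close> whose rows \<open>\<psi> (x, -)\<close> are \<open>\<T>\<close>-functors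
  \<open>Y \<rightarrow> \<V>\<close> (called presheaves below).  The point of the statement is that the remaining conditions
  on \<open>r\<close> and on \<open>\<psi>\<close> translate into each other, and two observations show this.

  First, a representable category is an ordinary \<open>\<V>\<close>-category with an action of the monad: if \<open>\<alpha>\<close> is
  left adjoint to the unit of \<open>X\<close>, then \<open>a = a\<^sub>0 \<cdot> \<alpha>\<close> (\<open>representable_structure\<close>).  So
  \<open>\<psi> \<cdot> a = \<psi> \<cdot> \<alpha>\<close> as soon as \<open>\<psi> \<cdot> a\<^sub>0 \<le> \<psi>\<close>.  Secondly, \<open>VY\<close> is representable, with left adjoint
  \<open>M \<pp> = \<mu> (\<pp>, -)\<close> for \<open>\<mu> = b \<cdot> T\<^sub>\<xi> ev\<close>, and is separated; and \<open>\<mu> \<cdot> T r = b \<cdot> T\<^sub>\<xi> \<psi>\<close>.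
  Hence \<open>M \<cdot> T r \<simeq> r \<cdot> \<alpha>\<close> says exactly that \<open>b \<cdot> T\<^sub>\<xi> \<psi> = \<psi> \<cdot> \<alpha> = \<psi> \<cdot> a\<close>.  Functoriality of \<open>r\<close>
  means \<open>\<psi> \<cdot> a \<le> \<mu> \<cdot> T r\<close>, one half of this equation, and evaluating the equation at \<open>e x\<close> shows that the
  rows of \<open>\<psi>\<close> are presheaves.  The last step needs \<open>T\<^sub>\<xi> \<psi> (e x, -) = \<xi> \<cdot> T (\<psi> (x, -))\<close>, where
  \<open>T 1 = 1\<close> enters (\<open>Txi_unit_left\<close>).

  The work lies in the representability of \<open>VY\<close>.  It rests on the calculus of \<open>T\<^sub>\<xi>\<close>: \<open>T\<^sub>\<xi>\<close> preserves
  composition and commutes with \<open>m\<close>, and in both cases one inequality comes from a weak pullback.  Since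
  \<open>VY\<close> reverses the pointwise order, \<open>v \<le> d (\<pp>, q)\<close> means \<open>v \<otimes> q \<le> \<mu> (\<pp>, -)\<close> for its structure \<open>d\<close>,
  so all required inequalities become inequalities about \<open>\<mu>\<close>.  Transitivity of \<open>VY\<close> follows from
  \<open>b \<cdot> T\<^sub>\<xi> b \<le> b \<cdot> m\<close>; functoriality of \<open>M\<close> needs the reverse inequality, which is where the
  representability of \<open>Y\<close> is used (\<open>structure_mult_le\<close>).
\<close>

section \<open>Quantales and relational composition\<close>

lemma mult_bot_right [simp]: "x * bot = (bot :: 'v::comm_quantale)"
  using mult_Sup[of x "{}"] by simp

lemma mult_bot_left [simp]: "bot * x = (bot :: 'v::comm_quantale)"
  using mult_bot_right[of x] by (simp add: mult.commute)

lemma quantale_mult_left_mono: "y \<le> z \<Longrightarrow> x * y \<le> x * z" for x y z :: "'v::comm_quantale"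
  using mult_Sup[of x "{y, z}"] by (simp add: sup.absorb2 le_iff_sup)

lemma quantale_mult_mono: "x \<le> x' \<Longrightarrow> y \<le> y' \<Longrightarrow> x * y \<le> x' * y'" for x y x' y' :: "'v::comm_quantale"
  by (metis quantale_mult_left_mono mult.commute order_trans)

lemma mult_SUP_left: "x * (SUP i\<in>I. f i) = (SUP i\<in>I. x * f i)" for x :: "'v::comm_quantale"
  by (simp add: mult_Sup image_image)

lemma mult_SUP_right: "(SUP i\<in>I. f i) * x = (SUP i\<in>I. f i * x)" for x :: "'v::comm_quantale"
  using mult_SUP_left[of x f I] by (simp add: mult.commute)

lemma one_le_mult: "1 \<le> x \<Longrightarrow> y \<le> x * y" for x y :: "'v::comm_quantale"
  using quantale_mult_mono[of 1 x y y] by simp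

lemma rcomp_upper: "y \<in> Y \<Longrightarrow> r (x, y) * s (y, z) \<le> rcomp Y s r (x, z)"
  unfolding rcomp_def by (auto intro: SUP_upper)

lemma rcomp_least: "(\<And>y. y \<in> Y \<Longrightarrow> r (x, y) * s (y, z) \<le> v) \<Longrightarrow> rcomp Y s r (x, z) \<le> v"
  unfolding rcomp_def by (auto intro: SUP_least)

lemma rcomp_rgraph: "f x \<in> Y \<Longrightarrow> rcomp Y s (rgraph f) (x, z) = s (f x, z)"
  by (intro antisym rcomp_least)
     (auto simp: rgraph_def rcomp_def intro: SUP_upper2[of "f x"])

lemma upair_in_uprod [simp]: "upair x y \<in> uprod X Y \<longleftrightarrow> x \<in> X \<and> y \<in> Y"
  by (auto simp: uprod_def)

lemma in_uprodE: "p \<in> uprod X Y \<Longrightarrow> (\<And>x y. p = upair x y \<Longrightarrow> x \<in> X \<Longrightarrow> y \<in> Y \<Longrightarrow> thesis) \<Longrightarrow> thesis"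
  by (auto simp: uprod_def)

lemma ufst_funcset [simp]: "ufst \<in> uprod X Y \<rightarrow> X" and usnd_funcset [simp]: "usnd \<in> uprod X Y \<rightarrow> Y"
  by (auto elim: in_uprodE)

lemma weak_pullbackI:
  assumes "p \<in> P \<rightarrow> A" "q \<in> P \<rightarrow> B" "f \<in> A \<rightarrow> C" "g \<in> B \<rightarrow> C" "\<And>w. w \<in> P \<Longrightarrow> f (p w) = g (q w)"
    and lift: "\<And>s t. s \<in> A \<Longrightarrow> t \<in> B \<Longrightarrow> f s = g t \<Longrightarrow> \<exists>w\<in>P. p w = s \<and> q w = t"
  shows "weak_pullback P A B C p q f g"
  unfolding weak_pullback_def
proof (intro conjI allI impI)
  fix Q h l
  assume *: "small Q \<and> h \<in> Q \<rightarrow> A \<and> l \<in> Q \<rightarrow> B \<and> (\<forall>z\<in>Q. f (h z) = g (l z))"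
  have "\<forall>z\<in>Q. \<exists>w. w \<in> P \<and> p w = h z \<and> q w = l z"
  proof
    fix z assume "z \<in> Q"
    then show "\<exists>w. w \<in> P \<and> p w = h z \<and> q w = l z" using * lift[of "h z" "l z"] by auto
  qed
  then obtain u where "\<forall>z\<in>Q. u z \<in> P \<and> p (u z) = h z \<and> q (u z) = l z" by metis
  then show "\<exists>u\<in>Q \<rightarrow> P. \<forall>z\<in>Q. p (u z) = h z \<and> q (u z) = l z" by (intro bexI[of _ u]) auto
qed (use assms in auto)

lemma weak_pullback_lift:
  assumes "weak_pullback P A B C p q f g" "s \<in> A" "t \<in> B" "f s = g t"
  shows "\<exists>w\<in>P. p w = s \<and> q w = t"
proof -
  have "\<exists>u\<in>{s} \<rightarrow> P. \<forall>z\<in>{s}. p (u z) = s \<and> q (u z) = t"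
    using assms(1) unfolding weak_pullback_def
    by (elim conjE, drule_tac x="{s}" in spec, drule_tac x="\<lambda>_. s" in spec, drule_tac x="\<lambda>_. t" in spec)
       (use assms in \<open>auto simp: small_insert small_empty\<close>)
  then show ?thesis by auto
qed


section \<open>Evaluating the extension along maps\<close>

locale top_theory_on =
  fixes \<T> :: "('u::set_universe, 'v::comm_quantale) top_theory"
  assumes theory_axioms: "topological_theory \<T>"
begin

abbreviation "T \<equiv> Tob \<T>"
abbreviation "e \<equiv> Tunit \<T>"
abbreviation "m \<equiv> Tmult \<T>"

abbreviation on_pairs :: "('u, 'v) vrel \<Rightarrow> 'u \<Rightarrow> 'v" where
  "on_pairs r \<equiv> \<lambda>p. r (ufst p, usnd p)"

lemma monad: "set_monad \<T>" and small_Vob [simp]: "small (Vob \<T>)" and inj_Venc: "inj (Venc \<T>)"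
  using theory_axioms by (auto simp: topological_theory_def)

lemmas theory_laws = theory_axioms[unfolded topological_theory_def, THEN conjunct2, THEN conjunct2, THEN conjunct2]
lemmas preserves_weak_pullback = theory_laws[THEN conjunct1, rule_format, OF conjI[OF _ conjI[OF _ conjI[OF _ conjI]]]]
lemmas mult_weak_pullback = theory_laws[THEN conjunct2, THEN conjunct1, rule_format, OF conjI[OF _ conjI]]
lemmas xi_laws = theory_laws[THEN conjunct2, THEN conjunct2]
lemmas xi_unit = xi_laws[THEN conjunct1, rule_format]
lemmas xi_mult = xi_laws[THEN conjunct2, THEN conjunct1, rule_format]
lemmas xi_times = xi_laws[THEN conjunct2, THEN conjunct2, THEN conjunct1, rule_format]
lemmas xi_one = xi_laws[THEN conjunct2, THEN conjunct2, THEN conjunct2, THEN conjunct1, rule_format]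
lemmas xi_push = xi_laws[THEN conjunct2, THEN conjunct2, THEN conjunct2, THEN conjunct2, rule_format,
  OF conjI[OF _ conjI]]

lemma set_functor: "set_functor \<T>" using monad by (simp add: set_monad_def)

lemma Vdec_Venc [simp]: "Vdec \<T> (Venc \<T> v) = v"
  by (simp add: Vdec_def inj_Venc)

lemma Venc_Vdec: "u \<in> Vob \<T> \<Longrightarrow> Venc \<T> (Vdec \<T> u) = u"
  by (auto simp: Vob_def)

lemma Venc_in_Vob [simp]: "Venc \<T> v \<in> Vob \<T>" by (simp add: Vob_def)

lemmas functor_laws = set_functor[unfolded set_functor_def]
lemmas functor_Tob = functor_laws[THEN conjunct1, rule_format]
lemmas functor_Tmap = functor_laws[THEN conjunct2, THEN conjunct1, rule_format, OF conjI[OF _ conjI]]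
lemmas functor_cong = functor_laws[THEN conjunct2, THEN conjunct2, THEN conjunct1, rule_format,
  OF conjI[OF _ conjI[OF _ conjI[OF _ conjI]]]]
lemmas functor_id = functor_laws[THEN conjunct2, THEN conjunct2, THEN conjunct2, THEN conjunct1, rule_format]
lemmas functor_comp = functor_laws[THEN conjunct2, THEN conjunct2, THEN conjunct2, THEN conjunct2, rule_format,
  OF conjI[OF _ conjI[OF _ conjI[OF _ conjI]]]]

lemmas monad_laws = monad[unfolded set_monad_def, THEN conjunct2]
lemmas monad_unit = monad_laws[THEN conjunct1, rule_format]
lemmas monad_mult = monad_laws[THEN conjunct2, THEN conjunct1, rule_format]
lemmas monad_natural = monad_laws[THEN conjunct2, THEN conjunct2, THEN conjunct1, rule_format,
  OF conjI[OF _ conjI]]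
lemmas monad_equations = monad_laws[THEN conjunct2, THEN conjunct2, THEN conjunct2, rule_format]

lemma small_T [simp]: "small X \<Longrightarrow> small (T X)"
  by (rule functor_Tob)

lemma small_uprod' [simp]: "small X \<Longrightarrow> small Y \<Longrightarrow> small (uprod X Y :: 'u set)"
  by (rule small_uprod)

lemma small_uone [simp]: "small (uone :: 'u set)"
  by (simp add: uone_def small_insert small_empty)

lemma Tmap_in [simp]: "small X \<Longrightarrow> small Y \<Longrightarrow> f \<in> X \<rightarrow> Y \<Longrightarrow> t \<in> T X \<Longrightarrow> Tmap \<T> X Y f t \<in> T Y"
  by (rule funcset_mem[OF functor_Tmap])

lemma Tmap_cong:
  assumes "small X" "small Y" "f \<in> X \<rightarrow> Y" and eq: "\<And>x. x \<in> X \<Longrightarrow> f x = g x" and "t \<in> T X"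
  shows "Tmap \<T> X Y f t = Tmap \<T> X Y g t"
proof -
  have "g \<in> X \<rightarrow> Y" using assms(3) by (auto simp: Pi_iff simp flip: eq)
  then show ?thesis using assms by (intro functor_cong) auto
qed

lemma Tmap_id: "small X \<Longrightarrow> (\<And>x. x \<in> X \<Longrightarrow> f x = x) \<Longrightarrow> t \<in> T X \<Longrightarrow> Tmap \<T> X X f t = t"
  using Tmap_cong[of X X "\<lambda>x. x" f t] functor_id[of X t] by auto

lemma Tmap_comp: "small X \<Longrightarrow> small Y \<Longrightarrow> small Z \<Longrightarrow> f \<in> X \<rightarrow> Y \<Longrightarrow> g \<in> Y \<rightarrow> Z \<Longrightarrow> t \<in> T X
    \<Longrightarrow> Tmap \<T> Y Z g (Tmap \<T> X Y f t) = Tmap \<T> X Z (\<lambda>x. g (f x)) t"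
  using functor_comp[of X Y Z f g t] by (simp add: comp_def)

lemma unit_in [simp]: "small X \<Longrightarrow> x \<in> X \<Longrightarrow> e X x \<in> T X"
  by (rule funcset_mem[OF monad_unit])

lemma mult_in [simp]: "small X \<Longrightarrow> P \<in> T (T X) \<Longrightarrow> m X P \<in> T X"
  by (rule funcset_mem[OF monad_mult])

lemma unit_natural: "small X \<Longrightarrow> small Y \<Longrightarrow> f \<in> X \<rightarrow> Y \<Longrightarrow> x \<in> X \<Longrightarrow> Tmap \<T> X Y f (e X x) = e Y (f x)"
  using monad_natural[of X Y f] by simp

lemma mult_natural: "small X \<Longrightarrow> small Y \<Longrightarrow> f \<in> X \<rightarrow> Y \<Longrightarrow> P \<in> T (T X)
    \<Longrightarrow> Tmap \<T> X Y f (m X P) = m Y (Tmap \<T> (T X) (T Y) (Tmap \<T> X Y f) P)"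
  using monad_natural[of X Y f] by simp

lemma mult_unit [simp]: "small X \<Longrightarrow> t \<in> T X \<Longrightarrow> m X (e (T X) t) = t"
  using monad_equations[of X] by simp

lemma mult_Tmap_unit [simp]: "small X \<Longrightarrow> t \<in> T X \<Longrightarrow> m X (Tmap \<T> X (T X) (e X) t) = t"
  using monad_equations[of X] by simp

text \<open>
  Weak pullbacks need only be tested on elements: if \<open>P\<close> contains a joint preimage of any two matching
  elements of \<open>A\<close> and \<open>B\<close>, then so does \<open>T P\<close> for \<open>T A\<close> and \<open>T B\<close>.
\<close>

lemma Tmap_lift:
  assumes "small P" "small A" "small B" "small C"
    and "p \<in> P \<rightarrow> A" "q \<in> P \<rightarrow> B" "f \<in> A \<rightarrow> C" "g \<in> B \<rightarrow> C" "\<And>w. w \<in> P \<Longrightarrow> f (p w) = g (q w)"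
    and "\<And>s t. s \<in> A \<Longrightarrow> t \<in> B \<Longrightarrow> f s = g t \<Longrightarrow> \<exists>w\<in>P. p w = s \<and> q w = t"
    and st: "s \<in> T A" "t \<in> T B" "Tmap \<T> A C f s = Tmap \<T> B C g t"
  shows "\<exists>w\<in>T P. Tmap \<T> P A p w = s \<and> Tmap \<T> P B q w = t"
proof -
  have "weak_pullback P A B C p q f g" using assms by (intro weak_pullbackI) auto
  then have "weak_pullback (T P) (T A) (T B) (T C) (Tmap \<T> P A p) (Tmap \<T> P B q) (Tmap \<T> A C f) (Tmap \<T> B C g)"
    using assms(1-4) by (intro preserves_weak_pullback)
  then show ?thesis by (rule weak_pullback_lift) (use st in auto)
qed

lemma mult_lift:
  assumes "small X" "small Y" "f \<in> X \<rightarrow> Y" "P \<in> T (T Y)" "t \<in> T X" "m Y P = Tmap \<T> X Y f t"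
  shows "\<exists>W\<in>T (T X). Tmap \<T> (T X) (T Y) (Tmap \<T> X Y f) W = P \<and> m X W = t"
proof -
  have "weak_pullback (T (T X)) (T (T Y)) (T X) (T Y)
      (Tmap \<T> (T X) (T Y) (Tmap \<T> X Y f)) (m X) (m Y) (Tmap \<T> X Y f)"
    using assms(1-3) by (rule mult_weak_pullback)
  then show ?thesis by (rule weak_pullback_lift) (use assms in auto)
qed

lemma xiT_cong: "small X \<Longrightarrow> (\<And>x. x \<in> X \<Longrightarrow> \<phi> x = \<psi> x) \<Longrightarrow> t \<in> T X \<Longrightarrow> xiT \<T> X \<phi> t = xiT \<T> X \<psi> t"
  unfolding xiT_def by (intro arg_cong[of _ _ "xi \<T>"] Tmap_cong) auto

lemma xiT_Tmap: "small X \<Longrightarrow> small Y \<Longrightarrow> f \<in> X \<rightarrow> Y \<Longrightarrow> t \<in> T X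
    \<Longrightarrow> xiT \<T> Y \<phi> (Tmap \<T> X Y f t) = xiT \<T> X (\<lambda>x. \<phi> (f x)) t"
  unfolding xiT_def by (subst Tmap_comp) (auto simp: comp_def)

lemma xiT_push: "small X \<Longrightarrow> small Y \<Longrightarrow> f \<in> X \<rightarrow> Y \<Longrightarrow> t \<in> T Y
    \<Longrightarrow> xiT \<T> Y (push X f \<phi>) t = (SUP s\<in>{s\<in>T X. Tmap \<T> X Y f s = t}. xiT \<T> X \<phi> s)"
  by (simp only: xi_push) (simp add: push_def)

lemma xiT_unit: "small X \<Longrightarrow> x \<in> X \<Longrightarrow> xiT \<T> X \<phi> (e X x) = \<phi> x"
  unfolding xiT_def by (subst unit_natural) (auto simp: xi_unit)

lemma xiT_mult:
  assumes "small X" "W \<in> T (T X)"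
  shows "xiT \<T> X \<phi> (m X W) = xiT \<T> (T X) (xiT \<T> X \<phi>) W"
proof -
  let ?f = "Tmap \<T> X (Vob \<T>) (Venc \<T> \<circ> \<phi>)"
  have f: "?f \<in> T X \<rightarrow> T (Vob \<T>)" using assms by auto
  have "xiT \<T> X \<phi> (m X W) = xi \<T> (m (Vob \<T>) (Tmap \<T> (T X) (T (Vob \<T>)) ?f W))"
    unfolding xiT_def by (subst mult_natural) (use assms in auto)
  also have "\<dots> = xiT \<T> (T (Vob \<T>)) (xi \<T>) (Tmap \<T> (T X) (T (Vob \<T>)) ?f W)"
    using f assms by (intro xi_mult) auto
  also have "\<dots> = xiT \<T> (T X) (\<lambda>t. xi \<T> (?f t)) W"
    using assms f by (intro xiT_Tmap) auto
  finally show ?thesis by (simp add: xiT_def[abs_def])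
qed

lemma xiT_times:
  assumes X: "small X" "t \<in> T X"
  shows "xiT \<T> X (\<lambda>x. \<phi> x * \<psi> x) t = xiT \<T> X \<phi> t * xiT \<T> X \<psi> t"
proof -
  let ?V = "Vob \<T>"
  let ?h = "\<lambda>x. upair (Venc \<T> (\<phi> x)) (Venc \<T> (\<psi> x))"
  let ?w = "Tmap \<T> X (uprod ?V ?V) ?h t"
  have h: "?h \<in> X \<rightarrow> uprod ?V ?V" by auto
  have w: "?w \<in> T (uprod ?V ?V)" using X h by simp
  have "xiT \<T> X (\<lambda>x. \<phi> x * \<psi> x) t = xiT \<T> (uprod ?V ?V) (\<lambda>p. Vdec \<T> (ufst p) * Vdec \<T> (usnd p)) ?w"
    by (subst xiT_Tmap) (use X h in auto)
  also have "\<dots> = xi \<T> (Tmap \<T> (uprod ?V ?V) ?V ufst ?w) * xi \<T> (Tmap \<T> (uprod ?V ?V) ?V usnd ?w)"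
    using w by (rule xi_times)
  also have "\<dots> = xiT \<T> X \<phi> t * xiT \<T> X \<psi> t"
    unfolding xiT_def using X h by (simp add: Tmap_comp comp_def)
  finally show ?thesis .
qed

lemma xiT_one:
  assumes "small X" "t \<in> T X" shows "xiT \<T> X (\<lambda>_. 1) t = 1"
proof -
  let ?f = "\<lambda>_. setcode {} :: 'u"
  have f: "?f \<in> X \<rightarrow> uone" by (simp add: uone_def)
  have "xiT \<T> uone (\<lambda>_. 1) (Tmap \<T> X uone ?f t) = 1"
    using Tmap_in[OF assms(1) _ f assms(2)] by (intro xi_one) auto
  then show ?thesis using assms f by (simp add: xiT_Tmap)
qed

text \<open>
  The larger function is the push-forward of the value function from the set of pairs
  \<open>(x, v)\<close> below its graph, and the smaller one is a section of that set; condition (c) on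
  push-forwards therefore yields monotonicity of \<open>\<xi>\<close>.
\<close>

lemma xiT_mono:
  assumes X: "small X" "t \<in> T X" and le: "\<And>x. x \<in> X \<Longrightarrow> \<phi> x \<le> \<psi> x"
  shows "xiT \<T> X \<phi> t \<le> xiT \<T> X \<psi> t"
proof -
  define S where "S = {p \<in> uprod X (Vob \<T>). Vdec \<T> (usnd p) \<le> \<psi> (ufst p)}"
  have S: "small S" using small_subset[of "uprod X (Vob \<T>)" S] X by (auto simp: S_def)
  have fst: "ufst \<in> S \<rightarrow> X" by (auto simp: S_def elim: in_uprodE)
  have push: "push S ufst (\<lambda>p. Vdec \<T> (usnd p)) x = \<psi> x" if "x \<in> X" for x
    unfolding push_def
  proof (rule antisym)
    show "\<psi> x \<le> (SUP p\<in>{p \<in> S. ufst p = x}. Vdec \<T> (usnd p))"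
      using that by (intro SUP_upper2[of "upair x (Venc \<T> (\<psi> x))"]) (auto simp: S_def)
  qed (auto simp: S_def intro: SUP_least)
  let ?g = "\<lambda>x. upair x (Venc \<T> (\<phi> x))"
  have g: "?g \<in> X \<rightarrow> S" using le by (auto simp: S_def)
  have id: "Tmap \<T> S X ufst (Tmap \<T> X S ?g t) = t"
    using X S g fst by (subst Tmap_comp) (auto intro: Tmap_id)
  have "xiT \<T> X \<phi> t = xiT \<T> S (\<lambda>p. Vdec \<T> (usnd p)) (Tmap \<T> X S ?g t)"
    using X S g by (simp add: xiT_Tmap)
  also have "\<dots> \<le> (SUP s\<in>{s\<in>T S. Tmap \<T> S X ufst s = t}. xiT \<T> S (\<lambda>p. Vdec \<T> (usnd p)) s)"
    using X S g id by (intro SUP_upper) auto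
  also have "\<dots> = xiT \<T> X (push S ufst (\<lambda>p. Vdec \<T> (usnd p))) t"
    using X S fst by (simp add: xiT_push)
  also have "\<dots> = xiT \<T> X \<psi> t" using X push by (intro xiT_cong) auto
  finally show ?thesis .
qed


section \<open>The extension of the functor to relations\<close>

lemma Txi_upper:
  "w \<in> T (uprod X Y) \<Longrightarrow> xiT \<T> (uprod X Y) (on_pairs r) w
     \<le> Txi \<T> X Y r (Tmap \<T> (uprod X Y) X ufst w, Tmap \<T> (uprod X Y) Y usnd w)"
  unfolding Txi_def by (auto intro: Sup_upper)

lemma Txi_least:
  "(\<And>w. w \<in> T (uprod X Y) \<Longrightarrow> Tmap \<T> (uprod X Y) X ufst w = \<xx> \<Longrightarrow> Tmap \<T> (uprod X Y) Y usnd w = \<yy>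
     \<Longrightarrow> xiT \<T> (uprod X Y) (on_pairs r) w \<le> v) \<Longrightarrow> Txi \<T> X Y r (\<xx>, \<yy>) \<le> v"
  unfolding Txi_def by (auto intro: Sup_least)

text \<open>A span \<open>X \<leftarrow> S \<rightarrow> Y\<close> provides witnesses for the supremum that defines \<open>T\<^sub>\<xi> r\<close>.\<close>

lemma Txi_span:
  assumes "small S" "small X" "small Y" "f \<in> S \<rightarrow> X" "g \<in> S \<rightarrow> Y" "s \<in> T S"
  shows "xiT \<T> S (\<lambda>s. r (f s, g s)) s \<le> Txi \<T> X Y r (Tmap \<T> S X f s, Tmap \<T> S Y g s)"
proof -
  let ?h = "\<lambda>s. upair (f s) (g s)"
  have h: "?h \<in> S \<rightarrow> uprod X Y" using assms by auto
  then show ?thesis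
    using Txi_upper[of "Tmap \<T> S (uprod X Y) ?h s" X Y r] assms
    by (simp add: Tmap_comp xiT_Tmap)
qed

lemma Txi_span_one:
  assumes "small S" "small X" "small Y" "f \<in> S \<rightarrow> X" "g \<in> S \<rightarrow> Y" "s \<in> T S"
    and "\<And>s. s \<in> S \<Longrightarrow> 1 \<le> r (f s, g s)"
  shows "1 \<le> Txi \<T> X Y r (Tmap \<T> S X f s, Tmap \<T> S Y g s)"
  using xiT_mono[of S s "\<lambda>_. 1" "\<lambda>s. r (f s, g s)"] Txi_span[of S X Y f g s r] assms
  by (auto simp: xiT_one intro: order_trans)

lemma Txi_mono:
  assumes "small X" "small Y" and "\<And>x y. x \<in> X \<Longrightarrow> y \<in> Y \<Longrightarrow> r (x, y) \<le> s (x, y)"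
  shows "Txi \<T> X Y r p \<le> Txi \<T> X Y s p"
proof (cases p)
  case [simp]: (Pair \<xx> \<yy>)
  show ?thesis unfolding Pair
  proof (rule Txi_least)
    fix w assume w: "w \<in> T (uprod X Y)" "Tmap \<T> (uprod X Y) X ufst w = \<xx>" "Tmap \<T> (uprod X Y) Y usnd w = \<yy>"
    have "xiT \<T> (uprod X Y) (on_pairs r) w \<le> xiT \<T> (uprod X Y) (on_pairs s) w"
      using assms w by (intro xiT_mono) (auto elim: in_uprodE)
    also have "\<dots> \<le> Txi \<T> X Y s (\<xx>, \<yy>)" using Txi_upper[OF w(1), of s] w by simp
    finally show "xiT \<T> (uprod X Y) (on_pairs r) w \<le> Txi \<T> X Y s (\<xx>, \<yy>)" .
  qed
qed

lemma Txi_cong: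
  assumes "small X" "small Y" and "\<And>x y. x \<in> X \<Longrightarrow> y \<in> Y \<Longrightarrow> r (x, y) = s (x, y)"
  shows "Txi \<T> X Y r p = Txi \<T> X Y s p"
  using assms by (intro antisym Txi_mono) auto

text \<open>
  A relational composite is a push-forward from \<open>X \<times> Y \<times> Z\<close>, so (c) expresses \<open>T\<^sub>\<xi>\<close> of it by
  elements of \<open>T (X \<times> Y \<times> Z)\<close>.  These restrict to \<open>X \<times> Y\<close> and \<open>Y \<times> Z\<close>; conversely matching elements
  over the two factors are glued because \<open>T\<close> preserves the weak pullback \<open>X \<times> Y \<times> Z\<close>.
\<close>

lemma Txi_rcomp:
  assumes X: "small X" and Y: "small Y" and Z: "small Z" and xz: "\<xx> \<in> T X" "\<zz> \<in> T Z"
  shows "Txi \<T> X Z (rcomp Y s r) (\<xx>, \<zz>) = rcomp (T Y) (Txi \<T> Y Z s) (Txi \<T> X Y r) (\<xx>, \<zz>)"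
proof -
  let ?XY = "uprod X Y" and ?YZ = "uprod Y Z" and ?XZ = "uprod X Z"
  let ?W = "uprod ?XY Z"
  \<comment> \<open>projections of the triple product \<open>(X \<times> Y) \<times> Z\<close>\<close>
  define p23 where "p23 = (\<lambda>w::'u. upair (usnd (ufst w)) (usnd w))"
  define p13 where "p13 = (\<lambda>w::'u. upair (ufst (ufst w)) (usnd w))"
  have sm: "small ?W" "small ?XY" "small ?YZ" "small ?XZ" using X Y Z by auto
  have p23: "p23 \<in> ?W \<rightarrow> ?YZ" and p13: "p13 \<in> ?W \<rightarrow> ?XZ"
    by (auto simp: p23_def p13_def elim!: in_uprodE)
  let ?\<phi> = "\<lambda>w. r (ufst (ufst w), usnd (ufst w)) * s (usnd (ufst w), usnd w)"
  have split: "xiT \<T> ?W ?\<phi> w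
      = xiT \<T> ?XY (on_pairs r) (Tmap \<T> ?W ?XY ufst w) * xiT \<T> ?YZ (on_pairs s) (Tmap \<T> ?W ?YZ p23 w)"
    if "w \<in> T ?W" for w
    using that sm p23 by (simp add: xiT_Tmap xiT_times p23_def)
  have comp: "xiT \<T> ?XZ (on_pairs (rcomp Y s r)) v
      = (SUP w\<in>{w\<in>T ?W. Tmap \<T> ?W ?XZ p13 w = v}. xiT \<T> ?W ?\<phi> w)" if v: "v \<in> T ?XZ" for v
  proof -
    have "on_pairs (rcomp Y s r) p = push ?W p13 ?\<phi> p" if p_in: "p \<in> ?XZ" for p
    proof -
      obtain x z where p: "p = upair x z" "x \<in> X" "z \<in> Z" using p_in by (rule in_uprodE)
      have "{w \<in> ?W. p13 w = p} = (\<lambda>y. upair (upair x y) z) ` Y"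
        using p by (auto simp: p13_def elim!: in_uprodE)
      then show ?thesis using p by (simp add: push_def rcomp_def image_image)
    qed
    then have "xiT \<T> ?XZ (on_pairs (rcomp Y s r)) v = xiT \<T> ?XZ (push ?W p13 ?\<phi>) v"
      using sm v by (intro xiT_cong) auto
    then show ?thesis using sm p13 v by (simp only: xiT_push)
  qed
  have p1: "Tmap \<T> ?XZ X ufst (Tmap \<T> ?W ?XZ p13 w) = Tmap \<T> ?XY X ufst (Tmap \<T> ?W ?XY ufst w)"
    and p2: "Tmap \<T> ?XY Y usnd (Tmap \<T> ?W ?XY ufst w) = Tmap \<T> ?YZ Y ufst (Tmap \<T> ?W ?YZ p23 w)"
    and p3: "Tmap \<T> ?XZ Z usnd (Tmap \<T> ?W ?XZ p13 w) = Tmap \<T> ?YZ Z usnd (Tmap \<T> ?W ?YZ p23 w)"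
    if "w \<in> T ?W" for w
    using that sm p13 p23 X Y Z by (simp_all add: Tmap_comp p13_def p23_def)
  show ?thesis
  proof (rule antisym)
    show "Txi \<T> X Z (rcomp Y s r) (\<xx>, \<zz>) \<le> rcomp (T Y) (Txi \<T> Y Z s) (Txi \<T> X Y r) (\<xx>, \<zz>)" (is "_ \<le> ?R")
    proof (rule Txi_least)
      fix v assume v: "v \<in> T ?XZ" "Tmap \<T> ?XZ X ufst v = \<xx>" "Tmap \<T> ?XZ Z usnd v = \<zz>"
      show "xiT \<T> ?XZ (on_pairs (rcomp Y s r)) v \<le> ?R"
        unfolding comp[OF v(1)]
      proof (rule SUP_least)
        fix w assume "w \<in> {w \<in> T ?W. Tmap \<T> ?W ?XZ p13 w = v}"
        then have w: "w \<in> T ?W" and wv: "Tmap \<T> ?W ?XZ p13 w = v" by auto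
        let ?y = "Tmap \<T> ?XY Y usnd (Tmap \<T> ?W ?XY ufst w)"
        have w1: "Tmap \<T> ?W ?XY ufst w \<in> T ?XY" and w2: "Tmap \<T> ?W ?YZ p23 w \<in> T ?YZ"
          using w sm p23 by auto
        have "xiT \<T> ?W ?\<phi> w \<le> Txi \<T> X Y r (\<xx>, ?y) * Txi \<T> Y Z s (?y, \<zz>)"
          unfolding split[OF w]
          using Txi_upper[OF w1, of r] Txi_upper[OF w2, of s] p1[OF w] p2[OF w] p3[OF w] v wv
          by (intro quantale_mult_mono) auto
        also have "\<dots> \<le> ?R" using w1 sm Y by (intro rcomp_upper) auto
        finally show "xiT \<T> ?W ?\<phi> w \<le> ?R" .
      qed
    qed
  next
    show "rcomp (T Y) (Txi \<T> Y Z s) (Txi \<T> X Y r) (\<xx>, \<zz>) \<le> Txi \<T> X Z (rcomp Y s r) (\<xx>, \<zz>)" (is "_ \<le> ?L")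
    proof (rule rcomp_least)
      fix \<yy> assume y: "\<yy> \<in> T Y"
      have glue: "xiT \<T> ?XY (on_pairs r) w1 * xiT \<T> ?YZ (on_pairs s) w2 \<le> ?L"
        if w1: "w1 \<in> T ?XY" "Tmap \<T> ?XY X ufst w1 = \<xx>" "Tmap \<T> ?XY Y usnd w1 = \<yy>"
          and w2: "w2 \<in> T ?YZ" "Tmap \<T> ?YZ Y ufst w2 = \<yy>" "Tmap \<T> ?YZ Z usnd w2 = \<zz>" for w1 w2
      proof -
        have "\<exists>w\<in>T ?W. Tmap \<T> ?W ?XY ufst w = w1 \<and> Tmap \<T> ?W ?YZ p23 w = w2"
        proof (rule Tmap_lift[of _ _ _ Y _ _ usnd ufst])
          fix u v assume "u \<in> ?XY" "v \<in> ?YZ" "usnd u = ufst v"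
          then show "\<exists>w\<in>?W. ufst w = u \<and> p23 w = v"
            by (intro bexI[of _ "upair u (usnd v)"]) (auto simp: p23_def elim!: in_uprodE)
        qed (use sm p23 Y w1 w2 in \<open>auto simp: p23_def\<close>)
        then obtain w where w: "w \<in> T ?W" and w12: "Tmap \<T> ?W ?XY ufst w = w1" "Tmap \<T> ?W ?YZ p23 w = w2"
          by blast
        let ?v = "Tmap \<T> ?W ?XZ p13 w"
        have v: "?v \<in> T ?XZ" using w sm p13 by simp
        have "xiT \<T> ?XY (on_pairs r) w1 * xiT \<T> ?YZ (on_pairs s) w2 = xiT \<T> ?W ?\<phi> w"
          using split[OF w] w12 by simp
        also have "\<dots> \<le> xiT \<T> ?XZ (on_pairs (rcomp Y s r)) ?v"
          unfolding comp[OF v] using w by (intro SUP_upper) auto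
        also have "\<dots> \<le> ?L"
          using Txi_upper[OF v, of "rcomp Y s r"] p1[OF w] p3[OF w] w1 w2 w12 by simp
        finally show ?thesis .
      qed
      \<comment> \<open>residuation turns distributivity of \<open>\<otimes>\<close> over both suprema into two upper bounds\<close>
      have "Txi \<T> Y Z s (\<yy>, \<zz>) \<le> qhom (Txi \<T> X Y r (\<xx>, \<yy>)) ?L"
      proof (rule Txi_least)
        fix w2 assume w2: "w2 \<in> T ?YZ" "Tmap \<T> ?YZ Y ufst w2 = \<yy>" "Tmap \<T> ?YZ Z usnd w2 = \<zz>"
        have "Txi \<T> X Y r (\<xx>, \<yy>) \<le> qhom (xiT \<T> ?YZ (on_pairs s) w2) ?L"
          by (rule Txi_least) (use glue w2 in \<open>simp add: qhom_adjoint[symmetric]\<close>)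
        then show "xiT \<T> ?YZ (on_pairs s) w2 \<le> qhom (Txi \<T> X Y r (\<xx>, \<yy>)) ?L"
          by (simp add: qhom_adjoint[symmetric] mult.commute)
      qed
      then show "Txi \<T> X Y r (\<xx>, \<yy>) * Txi \<T> Y Z s (\<yy>, \<zz>) \<le> ?L"
        by (simp add: qhom_adjoint[symmetric] mult.commute)
    qed
  qed
qed

text \<open>
  \<open>T\<^sub>\<xi> (r \<cdot> f) = T\<^sub>\<xi> r \<cdot> T f\<close>: elements of \<open>T (X' \<times> Y)\<close> over \<open>T f \<xx>\<close> lift to \<open>T (X \<times> Y)\<close>, since
  \<open>X \<times> Y\<close> is the pullback of \<open>X' \<times> Y\<close> along \<open>f\<close>.
\<close>

lemma Txi_precompose:
  assumes X: "small X" and X': "small X'" and Y: "small Y" and f: "f \<in> X \<rightarrow> X'" and xy: "\<xx> \<in> T X" "\<yy> \<in> T Y"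
  shows "Txi \<T> X Y (\<lambda>(x, y). r (f x, y)) (\<xx>, \<yy>) = Txi \<T> X' Y r (Tmap \<T> X X' f \<xx>, \<yy>)"
proof (rule antisym)
  let ?h = "\<lambda>p. upair (f (ufst p)) (usnd p)"
  have h: "?h \<in> uprod X Y \<rightarrow> uprod X' Y" using f by (auto elim!: in_uprodE)
  show "Txi \<T> X Y (\<lambda>(x, y). r (f x, y)) (\<xx>, \<yy>) \<le> Txi \<T> X' Y r (Tmap \<T> X X' f \<xx>, \<yy>)"
  proof (rule Txi_least)
    fix w assume w: "w \<in> T (uprod X Y)" "Tmap \<T> (uprod X Y) X ufst w = \<xx>" "Tmap \<T> (uprod X Y) Y usnd w = \<yy>"
    have f': "(\<lambda>p. f (ufst p)) \<in> uprod X Y \<rightarrow> X'" using f by (auto elim!: in_uprodE)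
    have "Tmap \<T> X X' f \<xx> = Tmap \<T> (uprod X Y) X' (\<lambda>p. f (ufst p)) w"
      using w X X' Y f by (auto simp: Tmap_comp)
    then show "xiT \<T> (uprod X Y) (on_pairs (\<lambda>(x, y). r (f x, y))) w \<le> Txi \<T> X' Y r (Tmap \<T> X X' f \<xx>, \<yy>)"
      using Txi_span[of "uprod X Y" X' Y "\<lambda>p. f (ufst p)" usnd w r] X X' Y f' w by auto
  qed
  show "Txi \<T> X' Y r (Tmap \<T> X X' f \<xx>, \<yy>) \<le> Txi \<T> X Y (\<lambda>(x, y). r (f x, y)) (\<xx>, \<yy>)"
  proof (rule Txi_least)
    fix w assume w: "w \<in> T (uprod X' Y)" "Tmap \<T> (uprod X' Y) X' ufst w = Tmap \<T> X X' f \<xx>"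
      "Tmap \<T> (uprod X' Y) Y usnd w = \<yy>"
    have "\<exists>v\<in>T (uprod X Y). Tmap \<T> (uprod X Y) X ufst v = \<xx> \<and> Tmap \<T> (uprod X Y) (uprod X' Y) ?h v = w"
    proof (rule Tmap_lift[of _ _ _ X' _ _ f ufst])
      fix s t assume "s \<in> X" "t \<in> uprod X' Y" "f s = ufst t"
      then show "\<exists>w\<in>uprod X Y. ufst w = s \<and> ?h w = t"
        by (intro bexI[of _ "upair s (usnd t)"]) (auto elim!: in_uprodE)
    qed (use X X' Y f h w xy in auto)
    then obtain v where v: "v \<in> T (uprod X Y)" "Tmap \<T> (uprod X Y) X ufst v = \<xx>"
      "Tmap \<T> (uprod X Y) (uprod X' Y) ?h v = w" by blast
    have "xiT \<T> (uprod X' Y) (on_pairs r) w = xiT \<T> (uprod X Y) (on_pairs (\<lambda>(x, y). r (f x, y))) v"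
      using v X X' Y h by (auto simp: xiT_Tmap)
    also have "\<dots> \<le> Txi \<T> X Y (\<lambda>(x, y). r (f x, y)) (\<xx>, Tmap \<T> (uprod X Y) Y usnd v)"
      using Txi_upper[OF v(1), of "\<lambda>(x, y). r (f x, y)"] v by simp
    also have "Tmap \<T> (uprod X Y) Y usnd v = \<yy>"
      using v w X X' Y h by (auto simp: Tmap_comp)
    finally show "xiT \<T> (uprod X' Y) (on_pairs r) w \<le> Txi \<T> X Y (\<lambda>(x, y). r (f x, y)) (\<xx>, \<yy>)" .
  qed
qed

lemma Txi_unit_le:
  assumes "small X" "small Y" "x \<in> X" "y \<in> Y"
  shows "r (x, y) \<le> Txi \<T> X Y r (e X x, e Y y)"
  using Txi_upper[of "e (uprod X Y) (upair x y)" X Y r] assms by (simp add: xiT_unit unit_natural)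

text \<open>
  As a function on \<open>T X \<times> T Y\<close>, \<open>T\<^sub>\<xi> r\<close> is the push-forward of \<open>\<xi> \<cdot> T r\<close> along
  \<open>\<langle>T \<pi>\<^sub>1, T \<pi>\<^sub>2\<rangle>\<close>, so by (c) an element witnessing \<open>T\<^sub>\<xi> (T\<^sub>\<xi> r)\<close> comes from \<open>T (T (X \<times> Y))\<close>
  and can be multiplied.
\<close>

lemma Txi_mult_le:
  assumes X: "small X" and Y: "small Y"
  shows "Txi \<T> (T X) (T Y) (Txi \<T> X Y r) (P, Q) \<le> Txi \<T> X Y r (m X P, m Y Q)"
proof (rule Txi_least)
  let ?XY = "uprod X Y" and ?TT = "uprod (T X) (T Y)"
  let ?h = "\<lambda>w. upair (Tmap \<T> ?XY X ufst w) (Tmap \<T> ?XY Y usnd w)"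
  have h: "?h \<in> T ?XY \<rightarrow> ?TT" using X Y by auto
  fix w assume w: "w \<in> T ?TT" "Tmap \<T> ?TT (T X) ufst w = P" "Tmap \<T> ?TT (T Y) usnd w = Q"
  have "on_pairs (Txi \<T> X Y r) p = push (T ?XY) ?h (xiT \<T> ?XY (on_pairs r)) p" if "p \<in> ?TT" for p
    using that unfolding Txi_def push_def by (auto elim!: in_uprodE intro!: arg_cong[of _ _ Sup])
  then have "xiT \<T> ?TT (on_pairs (Txi \<T> X Y r)) w = xiT \<T> ?TT (push (T ?XY) ?h (xiT \<T> ?XY (on_pairs r))) w"
    using X Y w by (intro xiT_cong) auto
  also have "\<dots> = (SUP W\<in>{W\<in>T (T ?XY). Tmap \<T> (T ?XY) ?TT ?h W = w}. xiT \<T> (T ?XY) (xiT \<T> ?XY (on_pairs r)) W)"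
    using X Y w h by (simp add: xiT_push)
  also have "\<dots> \<le> Txi \<T> X Y r (m X P, m Y Q)"
  proof (rule SUP_least)
    fix W assume "W \<in> {W\<in>T (T ?XY). Tmap \<T> (T ?XY) ?TT ?h W = w}"
    then have W: "W \<in> T (T ?XY)" and Ww: "Tmap \<T> (T ?XY) ?TT ?h W = w" by auto
    have "P = Tmap \<T> (T ?XY) (T X) (Tmap \<T> ?XY X ufst) W" "Q = Tmap \<T> (T ?XY) (T Y) (Tmap \<T> ?XY Y usnd) W"
      using w Ww W X Y h by (auto simp: Tmap_comp)
    then show "xiT \<T> (T ?XY) (xiT \<T> ?XY (on_pairs r)) W \<le> Txi \<T> X Y r (m X P, m Y Q)"
      using Txi_upper[of "m ?XY W" X Y r] W X Y by (simp add: xiT_mult mult_natural)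
  qed
  finally show "xiT \<T> ?TT (on_pairs (Txi \<T> X Y r)) w \<le> Txi \<T> X Y r (m X P, m Y Q)" .
qed

text \<open>
  \<open>T\<^sub>\<xi> r \<cdot> m\<^sub>X \<le> m\<^sub>Y \<cdot> T\<^sub>\<xi> (T\<^sub>\<xi> r)\<close>; here the naturality square of \<open>m\<close> at the first
  projection has to be a weak pullback.
\<close>

lemma Txi_mult_lift:
  assumes X: "small X" and Y: "small Y" and P: "P \<in> T (T X)" and y: "\<yy> \<in> T Y"
  shows "Txi \<T> X Y r (m X P, \<yy>) \<le> (SUP Q\<in>{Q\<in>T (T Y). m Y Q = \<yy>}. Txi \<T> (T X) (T Y) (Txi \<T> X Y r) (P, Q))"
proof (rule Txi_least)
  let ?XY = "uprod X Y"
  fix w assume w: "w \<in> T ?XY" "Tmap \<T> ?XY X ufst w = m X P" "Tmap \<T> ?XY Y usnd w = \<yy>"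
  obtain W where W: "W \<in> T (T ?XY)" "Tmap \<T> (T ?XY) (T X) (Tmap \<T> ?XY X ufst) W = P" "m ?XY W = w"
    using mult_lift[of ?XY X ufst P w] X Y P w by auto
  let ?Q = "Tmap \<T> (T ?XY) (T Y) (Tmap \<T> ?XY Y usnd) W"
  have Q: "?Q \<in> T (T Y)" using W X Y by auto
  have mQ: "m Y ?Q = \<yy>"
    using mult_natural[of ?XY Y usnd W] W X Y w by auto
  have "xiT \<T> ?XY (on_pairs r) w = xiT \<T> (T ?XY) (xiT \<T> ?XY (on_pairs r)) W"
    using W X Y by (auto simp: xiT_mult)
  also have "\<dots> \<le> xiT \<T> (T ?XY) (\<lambda>w. Txi \<T> X Y r (Tmap \<T> ?XY X ufst w, Tmap \<T> ?XY Y usnd w)) W"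
    using W X Y by (intro xiT_mono Txi_upper) auto
  also have "\<dots> \<le> Txi \<T> (T X) (T Y) (Txi \<T> X Y r) (P, ?Q)"
    using Txi_span[of "T ?XY" "T X" "T Y" "Tmap \<T> ?XY X ufst" "Tmap \<T> ?XY Y usnd" W "Txi \<T> X Y r"] W X Y
    by auto
  also have "\<dots> \<le> (SUP Q\<in>{Q\<in>T (T Y). m Y Q = \<yy>}. Txi \<T> (T X) (T Y) (Txi \<T> X Y r) (P, Q))"
    using Q mQ by (intro SUP_upper) auto
  finally show "xiT \<T> ?XY (on_pairs r) w
      \<le> (SUP Q\<in>{Q\<in>T (T Y). m Y Q = \<yy>}. Txi \<T> (T X) (T Y) (Txi \<T> X Y r) (P, Q))" .
qed


section \<open>Categories over the theory and representability\<close>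

lemma tcatI:
  assumes "small X" and refl: "\<And>x. x \<in> X \<Longrightarrow> 1 \<le> a (e X x, x)"
    and trans: "\<And>P \<xx> z. P \<in> T (T X) \<Longrightarrow> \<xx> \<in> T X \<Longrightarrow> z \<in> X \<Longrightarrow> Txi \<T> (T X) X a (P, \<xx>) * a (\<xx>, z) \<le> a (m X P, z)"
  shows "tcat \<T> X a"
  unfolding tcat_def rel_le_def
proof (intro conjI ballI)
  fix \<xx> x assume "\<xx> \<in> T X" "x \<in> X"
  then show "rconv (rgraph (e X)) (\<xx>, x) \<le> a (\<xx>, x)"
    using refl by (auto simp: rconv_def rgraph_def)
next
  fix \<xx> z assume x: "\<xx> \<in> T X" "z \<in> X"
  show "rcomp (T X) a (rcomp (T (T X)) (Txi \<T> (T X) X a) (rconv (rgraph (m X)))) (\<xx>, z) \<le> a (\<xx>, z)"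
  proof (rule rcomp_least)
    fix \<yy> assume y: "\<yy> \<in> T X"
    have "rcomp (T (T X)) (Txi \<T> (T X) X a) (rconv (rgraph (m X))) (\<xx>, \<yy>) \<le> qhom (a (\<yy>, z)) (a (\<xx>, z))"
      by (rule rcomp_least)
         (use x y trans in \<open>auto simp: rconv_def rgraph_def qhom_adjoint[symmetric]\<close>)
    then show "rcomp (T (T X)) (Txi \<T> (T X) X a) (rconv (rgraph (m X))) (\<xx>, \<yy>) * a (\<yy>, z) \<le> a (\<xx>, z)"
      by (simp add: qhom_adjoint)
  qed
qed (fact assms(1))

lemma tcat_small: "tcat \<T> X a \<Longrightarrow> small X"
  by (simp add: tcat_def)

lemma tcat_refl:
  assumes "tcat \<T> X a" "x \<in> X" shows "1 \<le> a (e X x, x)"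
proof -
  have "rconv (rgraph (e X)) (e X x, x) \<le> a (e X x, x)"
    using assms unit_in[of X x] by (simp add: tcat_def rel_le_def)
  then show ?thesis by (simp add: rconv_def rgraph_def)
qed

lemma tcat_trans:
  assumes X: "tcat \<T> X a" and P: "P \<in> T (T X)" and x: "\<xx> \<in> T X" "z \<in> X"
  shows "Txi \<T> (T X) X a (P, \<xx>) * a (\<xx>, z) \<le> a (m X P, z)"
proof -
  let ?c = "rcomp (T (T X)) (Txi \<T> (T X) X a) (rconv (rgraph (m X)))"
  have "Txi \<T> (T X) X a (P, \<xx>) \<le> ?c (m X P, \<xx>)"
    using rcomp_upper[OF P, of "rconv (rgraph (m X))" "m X P" "Txi \<T> (T X) X a" \<xx>]
    by (simp add: rconv_def rgraph_def)
  then have "Txi \<T> (T X) X a (P, \<xx>) * a (\<xx>, z) \<le> ?c (m X P, \<xx>) * a (\<xx>, z)"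
    by (rule quantale_mult_mono) simp
  also have "\<dots> \<le> rcomp (T X) a ?c (m X P, z)" using x by (intro rcomp_upper)
  also have "\<dots> \<le> a (m X P, z)"
    using X P x mult_in[of X P] by (simp add: tcat_def rel_le_def)
  finally show ?thesis .
qed

lemma under0_eq: "small X \<Longrightarrow> x \<in> X \<Longrightarrow> under0 \<T> X a (x, z) = a (e X x, z)"
  unfolding under0_def by (rule rcomp_rgraph) simp

lemma under0_trans:
  assumes X: "tcat \<T> X a" and x: "x \<in> X" "y \<in> X" "z \<in> X"
  shows "a (e X x, y) * a (e X y, z) \<le> a (e X x, z)"
proof -
  have sm: "small X" using X by (rule tcat_small)
  have "a (e X x, y) * a (e X y, z) \<le> Txi \<T> (T X) X a (e (T X) (e X x), e X y) * a (e X y, z)"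
    using x sm by (intro quantale_mult_mono Txi_unit_le) auto
  also have "\<dots> \<le> a (m X (e (T X) (e X x)), z)"
    using x sm by (intro tcat_trans[OF X]) auto
  finally show ?thesis using x sm by simp
qed

lemma Tstruct_eq:
  assumes "small X" "P \<in> T (T X)"
  shows "Tstruct \<T> X a (P, \<xx>) = (SUP Q\<in>{Q\<in>T (T X). m X Q = m X P}. Txi \<T> (T X) X a (Q, \<xx>))"
proof -
  have "rcomp (T X) (rconv (rgraph (m X))) (rgraph (m X)) (P, Q) = (if m X Q = m X P then 1 else bot :: 'v)" for Q
    using assms by (subst rcomp_rgraph) (auto simp: rconv_def rgraph_def)
  then show ?thesis
    unfolding Tstruct_def
    by (intro antisym rcomp_least)
       (auto simp: rcomp_def[of "T (T X)"] intro!: SUP_least intro: SUP_upper SUP_upper2)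
qed

lemma Tstruct_upper:
  assumes "small X" "P \<in> T (T X)" "Q \<in> T (T X)" "m X Q = m X P"
  shows "Txi \<T> (T X) X a (Q, \<xx>) \<le> Tstruct \<T> X a (P, \<xx>)"
  using assms by (auto simp: Tstruct_eq intro: SUP_upper)

lemma Tstruct_times_le:
  assumes "small X" "P \<in> T (T X)"
    and "\<And>Q. Q \<in> T (T X) \<Longrightarrow> m X Q = m X P \<Longrightarrow> Txi \<T> (T X) X a (Q, \<xx>) * u \<le> v"
  shows "Tstruct \<T> X a (P, \<xx>) * u \<le> v"
  using assms by (auto simp: Tstruct_eq mult_SUP_right intro: SUP_least)

text \<open>
  The structure of a representable category is determined by its underlying \<open>\<V>\<close>-category and
  the left adjoint of the unit: \<open>a = a\<^sub>0 \<cdot> \<alpha>\<close>.  One inequality is functoriality of \<open>\<alpha>\<close> and its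
  counit; for the other, the unit \<open>1 \<le> e \<cdot> \<alpha>\<close> in \<open>T X\<close> is unfolded and absorbed by transitivity.
\<close>

lemma representable_structure:
  assumes X: "tcat \<T> X a" and \<alpha>: "unit_left_adjoint \<T> X a \<alpha>" and x: "\<xx> \<in> T X" "z \<in> X"
  shows "a (\<xx>, z) = a (e X (\<alpha> \<xx>), z)"
proof (rule antisym)
  have sm: "small X" using X by (rule tcat_small)
  have \<alpha>_in: "\<alpha> \<in> T X \<rightarrow> X"
    and \<alpha>_functor: "\<And>P \<yy>. P \<in> T (T X) \<Longrightarrow> \<yy> \<in> T X \<Longrightarrow> Tstruct \<T> X a (P, \<yy>) \<le> a (Tmap \<T> (T X) X \<alpha> P, \<alpha> \<yy>)"
    and unit: "\<And>\<yy>. \<yy> \<in> T X \<Longrightarrow> 1 \<le> under0 \<T> (T X) (Tstruct \<T> X a) (\<yy>, e X (\<alpha> \<yy>))"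
    and counit: "\<And>y. y \<in> X \<Longrightarrow> 1 \<le> under0 \<T> X a (\<alpha> (e X y), y)"
    using \<alpha> by (auto simp: unit_left_adjoint_def adjunction_def tfunctor_def map_le_def)
  have \<alpha>x: "\<alpha> \<xx> \<in> X" "\<alpha> (e X z) \<in> X" using \<alpha>_in x sm by auto
  have "a (\<xx>, z) \<le> Txi \<T> (T X) X a (e (T X) \<xx>, e X z)"
    using x sm by (intro Txi_unit_le) auto
  also have "\<dots> \<le> Tstruct \<T> X a (e (T X) \<xx>, e X z)"
    using x sm by (intro Tstruct_upper) auto
  also have "\<dots> \<le> a (Tmap \<T> (T X) X \<alpha> (e (T X) \<xx>), \<alpha> (e X z))"
    using x sm by (intro \<alpha>_functor) auto
  also have "\<dots> = a (e X (\<alpha> \<xx>), \<alpha> (e X z))"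
    using x sm \<alpha>_in by (simp add: unit_natural)
  also have "\<dots> \<le> a (e X (\<alpha> (e X z)), z) * a (e X (\<alpha> \<xx>), \<alpha> (e X z))"
    using counit[OF x(2)] sm \<alpha>x by (intro one_le_mult) (simp add: under0_eq)
  also have "\<dots> \<le> a (e X (\<alpha> \<xx>), z)"
    using under0_trans[OF X \<alpha>x(1) \<alpha>x(2) x(2)] by (simp add: mult.commute)
  finally show "a (\<xx>, z) \<le> a (e X (\<alpha> \<xx>), z)" .
  have "1 \<le> Tstruct \<T> X a (e (T X) \<xx>, e X (\<alpha> \<xx>))"
    using unit[OF x(1)] sm x by (simp add: under0_eq)
  then have "a (e X (\<alpha> \<xx>), z) \<le> Tstruct \<T> X a (e (T X) \<xx>, e X (\<alpha> \<xx>)) * a (e X (\<alpha> \<xx>), z)"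
    by (rule one_le_mult)
  also have "\<dots> \<le> a (\<xx>, z)"
  proof (rule Tstruct_times_le[OF sm])
    fix Q assume "Q \<in> T (T X)" "m X Q = m X (e (T X) \<xx>)"
    then show "Txi \<T> (T X) X a (Q, e X (\<alpha> \<xx>)) * a (e X (\<alpha> \<xx>), z) \<le> a (\<xx>, z)"
      using tcat_trans[OF X, of Q "e X (\<alpha> \<xx>)" z] sm x \<alpha>x by simp
  qed (use sm x in simp)
  finally show "a (e X (\<alpha> \<xx>), z) \<le> a (\<xx>, z)" .
qed

text \<open>
  This is \<open>\<alpha> \<cdot> T \<alpha> \<le> \<alpha> \<cdot> m\<close>.  In \<open>T X\<close> the structure relates \<open>P\<close> to \<open>m P\<close>, because \<open>P\<close> and
  \<open>T e (m P)\<close> have the same product and \<open>T\<^sub>\<xi> a\<close> relates \<open>T e (m P)\<close> to \<open>m P\<close>; the functor \<open>\<alpha>\<close>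
  preserves this relation.
\<close>

lemma left_adjoint_mult:
  assumes X: "tcat \<T> X a" and \<alpha>: "unit_left_adjoint \<T> X a \<alpha>" and P: "P \<in> T (T X)"
  shows "1 \<le> a (Tmap \<T> (T X) X \<alpha> P, \<alpha> (m X P))"
proof -
  have sm: "small X" using X by (rule tcat_small)
  have e: "e X \<in> X \<rightarrow> T X" using sm by auto
  let ?Q = "Tmap \<T> X (T X) (e X) (m X P)"
  have "1 \<le> Txi \<T> (T X) X a (?Q, Tmap \<T> X X (\<lambda>x. x) (m X P))"
    using sm P e tcat_refl[OF X] by (intro Txi_span_one) auto
  also have "\<dots> = Txi \<T> (T X) X a (?Q, m X P)" using sm P by (simp add: Tmap_id)
  also have "\<dots> \<le> Tstruct \<T> X a (P, m X P)"
    using sm P e by (intro Tstruct_upper) auto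
  also have "\<dots> \<le> a (Tmap \<T> (T X) X \<alpha> P, \<alpha> (m X P))"
    using \<alpha> P mult_in[OF sm P] by (simp add: unit_left_adjoint_def adjunction_def tfunctor_def)
  finally show ?thesis .
qed

text \<open>
  \<open>a \<cdot> m \<le> a \<cdot> T\<^sub>\<xi> a\<close>, the converse of transitivity: \<open>T\<^sub>\<xi> a\<close> relates \<open>P\<close> to \<open>T \<alpha> P\<close>, so
  \<open>T \<alpha> P\<close> is an intermediate element for \<open>P\<close> and every target of \<open>m P\<close>.
\<close>

lemma structure_mult_le:
  assumes X: "tcat \<T> X a" and \<alpha>: "unit_left_adjoint \<T> X a \<alpha>" and P: "P \<in> T (T X)" and z: "z \<in> X"
  shows "a (m X P, z) \<le> rcomp (T X) a (Txi \<T> (T X) X a) (P, z)"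
proof -
  have sm: "small X" using X by (rule tcat_small)
  have \<alpha>_in: "\<alpha> \<in> T X \<rightarrow> X" using \<alpha> by (simp add: unit_left_adjoint_def adjunction_def tfunctor_def)
  let ?A = "Tmap \<T> (T X) X \<alpha> P"
  have A: "?A \<in> T X" "\<alpha> (m X P) \<in> X" "\<alpha> ?A \<in> X" using sm P \<alpha>_in by (auto intro!: funcset_mem[OF \<alpha>_in])
  have id: "Tmap \<T> (T X) (T X) (\<lambda>x. x) P = P" using P sm by (simp add: Tmap_id)
  have "1 \<le> a (e X (\<alpha> ?A), \<alpha> (m X P))"
    using left_adjoint_mult[OF X \<alpha> P] representable_structure[OF X \<alpha> A(1,2)] by simp
  then have "a (m X P, z) \<le> a (e X (\<alpha> ?A), \<alpha> (m X P)) * a (m X P, z)" by (rule one_le_mult)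
  also have "\<dots> \<le> a (e X (\<alpha> ?A), z)"
    using under0_trans[OF X A(3,2) z] representable_structure[OF X \<alpha> mult_in[OF sm P] z] by simp
  also have "\<dots> = a (?A, z)" using representable_structure[OF X \<alpha> A(1) z] by simp
  also have "\<dots> \<le> Txi \<T> (T X) X a (P, ?A) * a (?A, z)"
  proof (rule one_le_mult)
    have "1 \<le> a (x, \<alpha> x)" if "x \<in> T X" for x
      using representable_structure[OF X \<alpha> that] tcat_refl[OF X] funcset_mem[OF \<alpha>_in that] by simp
    then show "1 \<le> Txi \<T> (T X) X a (P, ?A)"
      using Txi_span_one[of "T X" "T X" X "\<lambda>x. x" \<alpha> P a] sm \<alpha>_in P id by simp
  qed
  also have "\<dots> \<le> rcomp (T X) a (Txi \<T> (T X) X a) (P, z)" using A by (intro rcomp_upper)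
  finally show ?thesis .
qed

lemma unit_tfunctor:
  assumes X: "small X"
  shows "tfunctor \<T> X a (T X) (Tstruct \<T> X a) (e X)"
  unfolding tfunctor_def
proof (intro conjI ballI)
  have e: "e X \<in> X \<rightarrow> T X" using X by auto
  then show "e X \<in> X \<rightarrow> T X" .
  fix \<xx> x assume x: "\<xx> \<in> T X" "x \<in> X"
  have "a (\<xx>, x) \<le> Txi \<T> (T X) X a (e (T X) \<xx>, e X x)" using X x by (intro Txi_unit_le) auto
  also have "\<dots> \<le> Tstruct \<T> X a (Tmap \<T> X (T X) (e X) \<xx>, e X x)"
    using X x e by (intro Tstruct_upper) auto
  finally show "a (\<xx>, x) \<le> Tstruct \<T> X a (Tmap \<T> X (T X) (e X) \<xx>, e X x)" .
qed


section \<open>The category of presheaves on \<open>Y\<close>\<close>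

text \<open>
  A \<open>\<T>\<close>-functor \<open>Y \<rightarrow> \<V>\<close> with its values taken in the quantale instead of the set encoding it, and
  with the internal hom of the functor condition moved to the other side.
\<close>

definition presheaf :: "'u set \<Rightarrow> ('u, 'v) vrel \<Rightarrow> ('u \<Rightarrow> 'v) \<Rightarrow> bool" where
  "presheaf Y b g \<longleftrightarrow> (\<forall>\<yy>\<in>T Y. \<forall>z\<in>Y. b (\<yy>, z) * xiT \<T> Y g \<yy> \<le> g z)"

abbreviation code :: "'u set \<Rightarrow> ('u \<Rightarrow> 'v) \<Rightarrow> 'u" where
  "code Y g \<equiv> fun_code Y (Venc \<T> \<circ> g)"

abbreviation "ev \<equiv> VY_ev \<T>"

lemma ev_code: "small Y \<Longrightarrow> y \<in> Y \<Longrightarrow> ev (code Y g, y) = g y"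
  by (simp add: VY_ev_def fun_app_fun_code)

lemma code_cong: "(\<And>y. y \<in> Y \<Longrightarrow> g y = h y) \<Longrightarrow> code Y g = code Y h"
  by (auto simp: fun_code_def intro!: arg_cong[of _ _ setcode] image_cong)

lemma presheaf_cong:
  assumes "small Y" "\<And>y. y \<in> Y \<Longrightarrow> g y = h y" shows "presheaf Y b g \<longleftrightarrow> presheaf Y b h"
  unfolding presheaf_def using assms xiT_cong[of Y g h] by simp

lemma VY_set_iff:
  assumes Y: "small Y"
  shows "p \<in> VY_set \<T> Y b \<longleftrightarrow> (\<exists>g. p = code Y g \<and> presheaf Y b g)"
proof
  assume "p \<in> VY_set \<T> Y b"
  then obtain \<phi> where p: "p = fun_code Y \<phi>" and \<phi>: "tfunctor \<T> Y b (Vob \<T>) (Vstruct \<T>) \<phi>"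
    by (auto simp: VY_set_def)
  have \<phi>_in: "\<phi> \<in> Y \<rightarrow> Vob \<T>" using \<phi> by (simp add: tfunctor_def)
  let ?g = "\<lambda>y. Vdec \<T> (\<phi> y)"
  have eq: "\<phi> y = (Venc \<T> \<circ> ?g) y" if "y \<in> Y" for y
    using funcset_mem[OF \<phi>_in that] by (simp add: Venc_Vdec)
  have "p = code Y ?g" unfolding p fun_code_def using eq
    by (intro arg_cong[of _ _ setcode] image_cong) auto
  moreover have "presheaf Y b ?g"
    unfolding presheaf_def
  proof (intro ballI)
    fix \<yy> z assume y: "\<yy> \<in> T Y" "z \<in> Y"
    have "xiT \<T> Y ?g \<yy> = xi \<T> (Tmap \<T> Y (Vob \<T>) \<phi> \<yy>)"
      unfolding xiT_def by (intro arg_cong[of _ _ "xi \<T>"] Tmap_cong) (use Y y eq \<phi>_in in auto)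
    then show "b (\<yy>, z) * xiT \<T> Y ?g \<yy> \<le> ?g z"
      using \<phi> y by (simp add: tfunctor_def Vstruct_def qhom_adjoint)
  qed
  ultimately show "\<exists>g. p = code Y g \<and> presheaf Y b g" by blast
next
  assume "\<exists>g. p = code Y g \<and> presheaf Y b g"
  then obtain g where p: "p = code Y g" and g: "presheaf Y b g" by blast
  have "tfunctor \<T> Y b (Vob \<T>) (Vstruct \<T>) (Venc \<T> \<circ> g)"
    using g by (auto simp: tfunctor_def Vstruct_def presheaf_def qhom_adjoint xiT_def)
  then show "p \<in> VY_set \<T> Y b" unfolding VY_set_def p by blast
qed

lemma code_in_VY: "small Y \<Longrightarrow> presheaf Y b g \<Longrightarrow> code Y g \<in> VY_set \<T> Y b"
  by (auto simp: VY_set_iff)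

lemma ev_presheaf:
  assumes "small Y" "p \<in> VY_set \<T> Y b" shows "presheaf Y b (\<lambda>y. ev (p, y))"
proof -
  obtain g where "p = code Y g" "presheaf Y b g" using assms by (auto simp: VY_set_iff)
  then show ?thesis using presheaf_cong[of Y "\<lambda>y. ev (p, y)" g b] assms by (simp add: ev_code)
qed

lemma VY_eqI:
  assumes "small Y" "p \<in> VY_set \<T> Y b" "q \<in> VY_set \<T> Y b" "\<And>y. y \<in> Y \<Longrightarrow> ev (p, y) = ev (q, y)"
  shows "p = q"
proof -
  obtain g h where "p = code Y g" "q = code Y h" using assms by (auto simp: VY_set_iff)
  then show ?thesis using assms(1,4) by (auto simp: ev_code intro!: code_cong)
qed

lemma small_VY [simp]:
  assumes Y: "small Y" shows "small (VY_set \<T> Y b)"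
proof (rule small_subset[OF small_Pow])
  show "small (uprod Y (Vob \<T>))" using Y by simp
  show "VY_set \<T> Y b \<subseteq> setcode ` Pow (uprod Y (Vob \<T>))"
    using Y by (auto simp: VY_set_iff fun_code_def intro!: imageI)
qed


lemma le_VY_struct_iff: "v \<le> VY_struct \<T> Y b (\<pp>, q) \<longleftrightarrow> (\<forall>y\<in>Y. v * ev (q, y) \<le> VY_mu \<T> Y b (\<pp>, y))"
  by (simp add: VY_struct_def le_INF_iff qhom_adjoint)

lemma VY_struct_ev_le: "y \<in> Y \<Longrightarrow> VY_struct \<T> Y b (\<pp>, q) * ev (q, y) \<le> VY_mu \<T> Y b (\<pp>, y)"
  using le_VY_struct_iff[of "VY_struct \<T> Y b (\<pp>, q)" Y b \<pp> q] by simp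

text \<open>
  \<open>\<mu> = b \<cdot> T\<^sub>\<xi> ev\<close> inherits this law from transitivity of \<open>b\<close>, since
  \<open>b \<cdot> T\<^sub>\<xi> \<mu> = b \<cdot> T\<^sub>\<xi> b \<cdot> T\<^sub>\<xi> (T\<^sub>\<xi> ev) \<le> b \<cdot> m \<cdot> T\<^sub>\<xi> (T\<^sub>\<xi> ev) \<le> b \<cdot> T\<^sub>\<xi> ev \<cdot> m\<close>.
\<close>

lemma Txi_mu_le:
  fixes b Y defines "W \<equiv> VY_set \<T> Y b"
  assumes Y: "tcat \<T> Y b" and P: "P \<in> T (T W)" and y: "\<yy> \<in> T Y" "z \<in> Y"
  shows "Txi \<T> (T W) Y (VY_mu \<T> Y b) (P, \<yy>) * b (\<yy>, z) \<le> VY_mu \<T> Y b (m W P, z)"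
proof -
  have sm: "small Y" using Y by (rule tcat_small)
  have W: "small W" using sm by (simp add: W_def)
  let ?E = "Txi \<T> W Y ev"
  have "Txi \<T> (T W) Y (VY_mu \<T> Y b) (P, \<yy>) = rcomp (T (T Y)) (Txi \<T> (T Y) Y b) (Txi \<T> (T W) (T Y) ?E) (P, \<yy>)"
    unfolding VY_mu_def W_def[symmetric] using sm W P y by (intro Txi_rcomp) auto
  also have "\<dots> \<le> qhom (b (\<yy>, z)) (VY_mu \<T> Y b (m W P, z))"
  proof (rule rcomp_least)
    fix Q assume Q: "Q \<in> T (T Y)"
    have "Txi \<T> (T W) (T Y) ?E (P, Q) * (Txi \<T> (T Y) Y b (Q, \<yy>) * b (\<yy>, z)) \<le> ?E (m W P, m Y Q) * b (m Y Q, z)"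
      using sm W y Q by (intro quantale_mult_mono Txi_mult_le tcat_trans[OF Y]) auto
    also have "\<dots> \<le> VY_mu \<T> Y b (m W P, z)"
      unfolding VY_mu_def W_def[symmetric] using sm Q by (intro rcomp_upper) auto
    finally show "Txi \<T> (T W) (T Y) ?E (P, Q) * Txi \<T> (T Y) Y b (Q, \<yy>) \<le> qhom (b (\<yy>, z)) (VY_mu \<T> Y b (m W P, z))"
      by (simp add: qhom_adjoint[symmetric] mult.assoc)
  qed
  finally show ?thesis by (simp add: qhom_adjoint)
qed

text \<open>
  The reverse inequality \<open>\<mu> \<cdot> m \<le> b \<cdot> T\<^sub>\<xi> \<mu>\<close> reverses both steps: \<open>T\<^sub>\<xi> ev \<cdot> m\<close> is lifted along \<open>m\<close>, and
  \<open>b \<cdot> m \<le> b \<cdot> T\<^sub>\<xi> b\<close> holds because \<open>Y\<close> is representable.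
\<close>

lemma mu_mult_le:
  fixes b Y defines "W \<equiv> VY_set \<T> Y b"
  assumes Y: "tcat \<T> Y b" and \<beta>: "unit_left_adjoint \<T> Y b \<beta>" and P: "P \<in> T (T W)" and z: "z \<in> Y"
  shows "VY_mu \<T> Y b (m W P, z) \<le> rcomp (T Y) b (Txi \<T> (T W) Y (VY_mu \<T> Y b)) (P, z)" (is "_ \<le> ?R")
proof -
  have sm: "small Y" using Y by (rule tcat_small)
  have W: "small W" using sm by (simp add: W_def)
  let ?E = "Txi \<T> W Y ev"
  have step: "Txi \<T> (T W) (T Y) ?E (P, Q) * b (m Y Q, z) \<le> ?R" if Q: "Q \<in> T (T Y)" for Q
  proof -
    have "Txi \<T> (T W) (T Y) ?E (P, Q) * b (m Y Q, z)
        \<le> Txi \<T> (T W) (T Y) ?E (P, Q) * rcomp (T Y) b (Txi \<T> (T Y) Y b) (Q, z)"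
      by (intro quantale_mult_left_mono structure_mult_le[OF Y \<beta> Q z])
    also have "\<dots> = (SUP \<yy>\<in>T Y. Txi \<T> (T W) (T Y) ?E (P, Q) * Txi \<T> (T Y) Y b (Q, \<yy>) * b (\<yy>, z))"
      by (simp add: rcomp_def mult_SUP_left mult.assoc)
    also have "\<dots> \<le> ?R"
    proof (rule SUP_least)
      fix \<yy> assume y: "\<yy> \<in> T Y"
      have "Txi \<T> (T W) (T Y) ?E (P, Q) * Txi \<T> (T Y) Y b (Q, \<yy>)
          \<le> rcomp (T (T Y)) (Txi \<T> (T Y) Y b) (Txi \<T> (T W) (T Y) ?E) (P, \<yy>)"
        using Q by (intro rcomp_upper)
      also have "\<dots> = Txi \<T> (T W) Y (VY_mu \<T> Y b) (P, \<yy>)"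
        unfolding VY_mu_def W_def[symmetric] using sm W P y by (intro Txi_rcomp[symmetric]) auto
      finally have "Txi \<T> (T W) (T Y) ?E (P, Q) * Txi \<T> (T Y) Y b (Q, \<yy>) * b (\<yy>, z)
          \<le> Txi \<T> (T W) Y (VY_mu \<T> Y b) (P, \<yy>) * b (\<yy>, z)"
        by (rule quantale_mult_mono) simp
      also have "\<dots> \<le> ?R" using y by (intro rcomp_upper)
      finally show "Txi \<T> (T W) (T Y) ?E (P, Q) * Txi \<T> (T Y) Y b (Q, \<yy>) * b (\<yy>, z) \<le> ?R" .
    qed
    finally show ?thesis .
  qed
  show ?thesis
    \<comment> \<open>only the \<open>\<mu>\<close> on the left-hand side is to be unfolded, so the other one is folded again\<close>
    unfolding VY_mu_def[of \<T> Y b] W_def[symmetric]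
  proof (subst VY_mu_def[symmetric, of \<T> Y b, folded W_def], rule rcomp_least)
    fix \<yy> assume y: "\<yy> \<in> T Y"
    have "?E (m W P, \<yy>)
        \<le> (SUP Q\<in>{Q\<in>T (T Y). m Y Q = \<yy>}. Txi \<T> (T W) (T Y) ?E (P, Q))"
      using W sm P y by (rule Txi_mult_lift)
    then have "?E (m W P, \<yy>) * b (\<yy>, z)
        \<le> (SUP Q\<in>{Q\<in>T (T Y). m Y Q = \<yy>}. Txi \<T> (T W) (T Y) ?E (P, Q)) * b (\<yy>, z)"
      by (rule quantale_mult_mono) simp
    also have "\<dots> \<le> ?R" unfolding mult_SUP_right using step by (auto intro!: SUP_least)
    finally show "?E (m W P, \<yy>) * b (\<yy>, z) \<le> ?R" .
  qed
qed

lemma Txi_VY_struct_mu_le: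
  fixes b Y defines "W \<equiv> VY_set \<T> Y b"
  assumes Y: "tcat \<T> Y b" and P: "P \<in> T (T W)" and q: "\<qq> \<in> T W" and y: "y \<in> Y"
  shows "Txi \<T> (T W) W (VY_struct \<T> Y b) (P, \<qq>) * VY_mu \<T> Y b (\<qq>, y) \<le> VY_mu \<T> Y b (m W P, y)"
proof -
  have sm: "small Y" using Y by (rule tcat_small)
  have W: "small W" using sm by (simp add: W_def)
  let ?d = "VY_struct \<T> Y b" and ?\<mu> = "VY_mu \<T> Y b"
  have "?\<mu> (\<qq>, y) \<le> qhom (Txi \<T> (T W) W ?d (P, \<qq>)) (?\<mu> (m W P, y))"
    \<comment> \<open>only the \<open>\<mu>\<close> on the left-hand side is to be unfolded, so the other one is folded again\<close>
    unfolding VY_mu_def[of \<T> Y b] W_def[symmetric]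
  proof (subst (2) VY_mu_def[symmetric, of \<T> Y b, folded W_def], rule rcomp_least)
    fix \<yy> assume y': "\<yy> \<in> T Y"
    have "Txi \<T> (T W) W ?d (P, \<qq>) * Txi \<T> W Y ev (\<qq>, \<yy>) \<le> rcomp (T W) (Txi \<T> W Y ev) (Txi \<T> (T W) W ?d) (P, \<yy>)"
      using q by (intro rcomp_upper)
    also have "\<dots> = Txi \<T> (T W) Y (rcomp W ev ?d) (P, \<yy>)"
      using W sm P y' by (intro Txi_rcomp[symmetric]) auto
    also have "\<dots> \<le> Txi \<T> (T W) Y ?\<mu> (P, \<yy>)"
      using W sm by (intro Txi_mono rcomp_least VY_struct_ev_le) auto
    finally have "Txi \<T> (T W) W ?d (P, \<qq>) * Txi \<T> W Y ev (\<qq>, \<yy>) * b (\<yy>, y) \<le> Txi \<T> (T W) Y ?\<mu> (P, \<yy>) * b (\<yy>, y)"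
      by (rule quantale_mult_mono) simp
    also have "\<dots> \<le> ?\<mu> (m W P, y)"
      using Txi_mu_le[OF Y, of P \<yy> y] P y y' by (simp add: W_def)
    finally show "Txi \<T> W Y ev (\<qq>, \<yy>) * b (\<yy>, y) \<le> qhom (Txi \<T> (T W) W ?d (P, \<qq>)) (?\<mu> (m W P, y))"
      by (simp add: qhom_adjoint[symmetric] ac_simps)
  qed
  then show ?thesis by (simp add: qhom_adjoint[symmetric] mult.commute)
qed

end

locale top_theory_point = top_theory_on \<T> for \<T> :: "('u::set_universe, 'v::comm_quantale) top_theory" +
  assumes T_one: "\<exists>t. Tob \<T> uone = {t}"
begin

text \<open>
  An element of \<open>T (X \<times> Y)\<close> over \<open>e x\<close> lies over the image of \<open>T 1\<close> under \<open>x : 1 \<rightarrow> X\<close>, hence comes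
  from \<open>T (1 \<times> Y)\<close>.  As \<open>T 1\<close> is a singleton, every element of \<open>T Y\<close> occurs in this way, and
  \<open>T\<^sub>\<xi> r\<close> restricts to \<open>\<xi> \<cdot> T (r (x, -))\<close> along \<open>e x\<close>.
\<close>

lemma Txi_unit_left:
  assumes X: "small X" and Y: "small Y" and x: "x \<in> X" and y: "\<yy> \<in> T Y"
  shows "Txi \<T> X Y r (e X x, \<yy>) = xiT \<T> Y (\<lambda>y. r (x, y)) \<yy>"
proof -
  have o: "setcode {} \<in> (uone :: 'u set)" by (simp add: uone_def)
  let ?o = "setcode {} :: 'u"
  have ex: "e X x = Tmap \<T> uone X (\<lambda>_. x) (e uone ?o)" using X x o by (simp add: unit_natural)
  have id: "Tmap \<T> Y Y (\<lambda>y. y) \<yy> = \<yy>" using Y y by (simp add: Tmap_id)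
  have "Tmap \<T> Y uone (\<lambda>_. ?o) \<yy> \<in> T uone" using Y y o by (intro Tmap_in) auto
  moreover have "e uone ?o \<in> T uone" using o by simp
  ultimately have "Tmap \<T> Y uone (\<lambda>_. ?o) \<yy> = e uone ?o" using T_one by auto
  then have const: "Tmap \<T> Y X (\<lambda>_. x) \<yy> = e X x"
    using X Y x y o Tmap_comp[of Y uone X "\<lambda>_. ?o" "\<lambda>_. x" \<yy>] by (simp add: ex)
  show ?thesis
  proof (rule antisym)
    show "xiT \<T> Y (\<lambda>y. r (x, y)) \<yy> \<le> Txi \<T> X Y r (e X x, \<yy>)"
      using Txi_span[of Y X Y "\<lambda>_. x" "\<lambda>y. y" \<yy> r] X Y x y const id by simp
    show "Txi \<T> X Y r (e X x, \<yy>) \<le> xiT \<T> Y (\<lambda>y. r (x, y)) \<yy>"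
    proof (rule Txi_least)
      fix w assume w: "w \<in> T (uprod X Y)" "Tmap \<T> (uprod X Y) X ufst w = e X x" "Tmap \<T> (uprod X Y) Y usnd w = \<yy>"
      have "\<exists>v\<in>T Y. Tmap \<T> Y uone (\<lambda>_. ?o) v = e uone ?o \<and> Tmap \<T> Y (uprod X Y) (upair x) v = w"
      proof (rule Tmap_lift[of _ _ _ X _ _ "\<lambda>_. x" ufst])
        fix s t :: 'u assume "s \<in> uone" "t \<in> uprod X Y" "x = ufst t"
        then show "\<exists>w\<in>Y. ?o = s \<and> upair x w = t" by (auto simp: uone_def elim!: in_uprodE)
      qed (use X Y x o w ex in auto)
      then obtain v where v: "v \<in> T Y" "Tmap \<T> Y (uprod X Y) (upair x) v = w" by blast
      have "\<yy> = v" using w v X Y x by (auto simp: Tmap_comp Tmap_id)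
      then show "xiT \<T> (uprod X Y) (on_pairs r) w \<le> xiT \<T> Y (\<lambda>y. r (x, y)) \<yy>"
        using v X Y x xiT_Tmap[of Y "uprod X Y" "upair x" v "on_pairs r"] by auto
    qed
  qed
qed

end

locale presheaf_category = top_theory_point \<T> for \<T> :: "('u::set_universe, 'v::comm_quantale) top_theory" +
  fixes Y :: "'u set" and b :: "('u, 'v) vrel" and \<beta> :: "'u \<Rightarrow> 'u"
  assumes tcat_Y: "tcat \<T> Y b" and left_adjoint_Y: "unit_left_adjoint \<T> Y b \<beta>"
begin

abbreviation "W \<equiv> VY_set \<T> Y b"
abbreviation "d \<equiv> VY_struct \<T> Y b"
abbreviation "\<mu> \<equiv> VY_mu \<T> Y b"

lemma small_Y [simp]: "small Y" using tcat_Y by (rule tcat_small)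

lemma mu_unit:
  assumes p: "p \<in> W" and y: "y \<in> Y" shows "\<mu> (e W p, y) = ev (p, y)"
proof (rule antisym)
  have "presheaf Y b (\<lambda>y. ev (p, y))" using p by (intro ev_presheaf) auto
  then show "\<mu> (e W p, y) \<le> ev (p, y)"
    unfolding VY_mu_def using p y
    by (intro rcomp_least) (simp add: Txi_unit_left presheaf_def mult.commute)
  have "ev (p, y) \<le> b (e Y y, y) * ev (p, y)" by (intro one_le_mult tcat_refl[OF tcat_Y] y)
  also have "\<dots> \<le> Txi \<T> W Y ev (e W p, e Y y) * b (e Y y, y)"
    using p y by (subst mult.commute) (intro quantale_mult_mono Txi_unit_le, auto)
  also have "\<dots> \<le> \<mu> (e W p, y)" unfolding VY_mu_def using y by (intro rcomp_upper) auto
  finally show "ev (p, y) \<le> \<mu> (e W p, y)" .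
qed

lemma mu_presheaf:
  assumes p: "\<pp> \<in> T W" shows "presheaf Y b (\<lambda>y. \<mu> (\<pp>, y))"
  unfolding presheaf_def
proof (intro ballI)
  fix \<yy> z assume y: "\<yy> \<in> T Y" "z \<in> Y"
  have "b (\<yy>, z) * xiT \<T> Y (\<lambda>y. \<mu> (\<pp>, y)) \<yy> = Txi \<T> (T W) Y \<mu> (e (T W) \<pp>, \<yy>) * b (\<yy>, z)"
    using p y by (simp add: Txi_unit_left mult.commute)
  also have "\<dots> \<le> \<mu> (\<pp>, z)" using Txi_mu_le[OF tcat_Y _ y, of "e (T W) \<pp>"] p by simp
  finally show "b (\<yy>, z) * xiT \<T> Y (\<lambda>y. \<mu> (\<pp>, y)) \<yy> \<le> \<mu> (\<pp>, z)" .
qed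

definition M :: "'u \<Rightarrow> 'u" where "M \<pp> = code Y (\<lambda>y. \<mu> (\<pp>, y))"

lemma M_in: "\<pp> \<in> T W \<Longrightarrow> M \<pp> \<in> W"
  unfolding M_def by (intro code_in_VY mu_presheaf) auto

lemma ev_M: "y \<in> Y \<Longrightarrow> ev (M \<pp>, y) = \<mu> (\<pp>, y)"
  by (simp add: M_def ev_code)

lemma one_le_VY_struct_unit_iff:
  "p \<in> W \<Longrightarrow> 1 \<le> d (e W p, q) \<longleftrightarrow> (\<forall>y\<in>Y. ev (q, y) \<le> ev (p, y))"
  by (simp add: le_VY_struct_iff mu_unit)

text \<open>The order of \<open>VY\<close> is the reversed pointwise one, so equivalent maps into \<open>VY\<close> are equal.\<close>

lemma map_equiv_VY_iff:
  assumes "f \<in> S \<rightarrow> W" "g \<in> S \<rightarrow> W"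
  shows "map_equiv \<T> S W d f g \<longleftrightarrow> (\<forall>s\<in>S. f s = g s)"
proof -
  have "map_equiv \<T> S W d f g \<longleftrightarrow> (\<forall>s\<in>S. \<forall>y\<in>Y. ev (f s, y) = ev (g s, y))"
    using assms unfolding map_equiv_def map_le_def
    by (auto simp: under0_eq one_le_VY_struct_unit_iff Pi_iff intro: antisym)
  also have "\<dots> \<longleftrightarrow> (\<forall>s\<in>S. f s = g s)"
    using assms by (fastforce intro: VY_eqI[of Y])
  finally show ?thesis .
qed

lemma tcat_VY: "tcat \<T> W d"
proof (rule tcatI)
  fix P \<qq> z assume *: "P \<in> T (T W)" "\<qq> \<in> T W" "z \<in> W"
  show "Txi \<T> (T W) W d (P, \<qq>) * d (\<qq>, z) \<le> d (m W P, z)"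
    unfolding le_VY_struct_iff
  proof
    fix y assume y: "y \<in> Y"
    have "Txi \<T> (T W) W d (P, \<qq>) * d (\<qq>, z) * ev (z, y) \<le> Txi \<T> (T W) W d (P, \<qq>) * \<mu> (\<qq>, y)"
      unfolding mult.assoc by (intro quantale_mult_left_mono VY_struct_ev_le y)
    also have "\<dots> \<le> \<mu> (m W P, y)" using * y by (intro Txi_VY_struct_mu_le tcat_Y)
    finally show "Txi \<T> (T W) W d (P, \<qq>) * d (\<qq>, z) * ev (z, y) \<le> \<mu> (m W P, y)" .
  qed
qed (simp_all add: one_le_VY_struct_unit_iff)

text \<open>
  Functoriality of \<open>M\<close> amounts to \<open>\<mu> \<cdot> T\<^sub>\<xi> d \<le> \<mu> \<cdot> T M\<close>.  As \<open>\<mu> \<cdot> T\<^sub>\<xi> d \<le> \<mu> \<cdot> m\<close>, and \<open>ev \<cdot> M = \<mu>\<close>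
  gives \<open>\<mu> \<cdot> T M = b \<cdot> T\<^sub>\<xi> \<mu>\<close>, it reduces to \<open>\<mu> \<cdot> m \<le> b \<cdot> T\<^sub>\<xi> \<mu>\<close>.
\<close>

lemma left_adjoint_VY: "unit_left_adjoint \<T> W d M"
  unfolding unit_left_adjoint_def adjunction_def
proof (intro conjI)
  have M: "M \<in> T W \<rightarrow> W" using M_in by auto
  have muTM: "\<mu> (Tmap \<T> (T W) W M P, y) = rcomp (T Y) b (Txi \<T> (T W) Y \<mu>) (P, y)"
    if P: "P \<in> T (T W)" for P y
  proof -
    have "Txi \<T> (T W) Y \<mu> (P, \<yy>) = Txi \<T> W Y ev (Tmap \<T> (T W) W M P, \<yy>)" if "\<yy> \<in> T Y" for \<yy>
    proof -
      have "Txi \<T> (T W) Y \<mu> (P, \<yy>) = Txi \<T> (T W) Y (\<lambda>(\<pp>, y). ev (M \<pp>, y)) (P, \<yy>)"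
        by (intro Txi_cong) (simp_all add: ev_M)
      also have "\<dots> = Txi \<T> W Y ev (Tmap \<T> (T W) W M P, \<yy>)"
        using M P that by (intro Txi_precompose) auto
      finally show ?thesis .
    qed
    then show ?thesis unfolding VY_mu_def[of \<T> Y b] by (simp add: rcomp_def)
  qed
  show "tfunctor \<T> (T W) (Tstruct \<T> W d) W d M"
    unfolding tfunctor_def
  proof (intro conjI ballI M)
    fix P \<qq> assume P: "P \<in> T (T W)" and q: "\<qq> \<in> T W"
    show "Tstruct \<T> W d (P, \<qq>) \<le> d (Tmap \<T> (T W) W M P, M \<qq>)"
      unfolding le_VY_struct_iff
    proof
      fix y assume y: "y \<in> Y"
      have "Tstruct \<T> W d (P, \<qq>) * ev (M \<qq>, y) \<le> \<mu> (m W P, y)"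
      proof (rule Tstruct_times_le)
        fix Q assume "Q \<in> T (T W)" "m W Q = m W P"
        then show "Txi \<T> (T W) W d (Q, \<qq>) * ev (M \<qq>, y) \<le> \<mu> (m W P, y)"
          using Txi_VY_struct_mu_le[OF tcat_Y, of Q \<qq> y] q y by (simp add: ev_M)
      qed (use P in simp_all)
      also have "\<dots> \<le> \<mu> (Tmap \<T> (T W) W M P, y)"
        using mu_mult_le[OF tcat_Y left_adjoint_Y P y] muTM[OF P] by simp
      finally show "Tstruct \<T> W d (P, \<qq>) * ev (M \<qq>, y) \<le> \<mu> (Tmap \<T> (T W) W M P, y)" .
    qed
  qed
  show "tfunctor \<T> W d (T W) (Tstruct \<T> W d) (e W)" by (rule unit_tfunctor) simp
  show "map_le \<T> (T W) (T W) (Tstruct \<T> W d) (\<lambda>x. x) (e W \<circ> M)"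
    unfolding map_le_def
  proof
    fix \<pp> assume p: "\<pp> \<in> T W"
    have "1 \<le> d (\<pp>, M \<pp>)" by (simp add: le_VY_struct_iff ev_M)
    also have "\<dots> \<le> Txi \<T> (T W) W d (e (T W) \<pp>, e W (M \<pp>))"
      using p M_in[OF p] by (intro Txi_unit_le) auto
    also have "\<dots> \<le> Tstruct \<T> W d (e (T W) \<pp>, e W (M \<pp>))"
      using p by (intro Tstruct_upper) auto
    finally show "1 \<le> under0 \<T> (T W) (Tstruct \<T> W d) (\<pp>, (e W \<circ> M) \<pp>)"
      using p by (simp add: under0_eq)
  qed
  show "map_le \<T> W W d (M \<circ> e W) (\<lambda>p. p)"
    unfolding map_le_def
    by (simp add: under0_eq M_in one_le_VY_struct_unit_iff ev_M mu_unit)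
qed

lemma representable_VY: "representable \<T> W d"
  unfolding representable_def using tcat_VY left_adjoint_VY by blast

lemma left_adjoint_VY_unique:
  assumes \<gamma>: "unit_left_adjoint \<T> W d \<gamma>" and p: "\<pp> \<in> T W"
  shows "\<gamma> \<pp> = M \<pp>"
proof -
  have \<gamma>_in: "\<gamma> \<pp> \<in> W"
    using \<gamma> p by (auto simp: unit_left_adjoint_def adjunction_def tfunctor_def)
  have *: "d (e W (M \<pp>), q) = d (e W (\<gamma> \<pp>), q)" if "q \<in> W" for q
    using representable_structure[OF tcat_VY left_adjoint_VY p that] representable_structure[OF tcat_VY \<gamma> p that]
    by simp
  have "1 \<le> d (e W (M \<pp>), \<gamma> \<pp>)" "1 \<le> d (e W (\<gamma> \<pp>), M \<pp>)"
    using *[OF \<gamma>_in] *[OF M_in[OF p]] tcat_refl[OF tcat_VY \<gamma>_in] tcat_refl[OF tcat_VY M_in[OF p]]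
    by simp_all
  then have "ev (\<gamma> \<pp>, y) = ev (M \<pp>, y)" if "y \<in> Y" for y
    using \<gamma>_in M_in[OF p] that by (auto simp: one_le_VY_struct_unit_iff intro: antisym)
  then show ?thesis using \<gamma>_in M_in[OF p] by (intro VY_eqI[of Y]) auto
qed


section \<open>Distributors and homomorphisms into the presheaf category\<close>

text \<open>\<open>\<mu> \<cdot> T r = b \<cdot> T\<^sub>\<xi> \<psi>\<close>, for \<open>\<psi>\<close> the relation \<open>ev \<cdot> r\<close>.\<close>

lemma mu_Tmap:
  assumes X: "small X" and r: "r \<in> X \<rightarrow> W" and x: "\<xx> \<in> T X"
    and \<psi>: "\<And>x y. x \<in> X \<Longrightarrow> y \<in> Y \<Longrightarrow> \<psi> (x, y) = ev (r x, y)"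
  shows "\<mu> (Tmap \<T> X W r \<xx>, y) = rcomp (T Y) b (Txi \<T> X Y \<psi>) (\<xx>, y)"
proof -
  have "Txi \<T> X Y \<psi> (\<xx>, \<yy>) = Txi \<T> W Y ev (Tmap \<T> X W r \<xx>, \<yy>)" if "\<yy> \<in> T Y" for \<yy>
  proof -
    have "Txi \<T> X Y \<psi> (\<xx>, \<yy>) = Txi \<T> X Y (\<lambda>(x, y). ev (r x, y)) (\<xx>, \<yy>)"
      using X \<psi> by (intro Txi_cong) auto
    also have "\<dots> = Txi \<T> W Y ev (Tmap \<T> X W r \<xx>, \<yy>)"
      using X r x that by (intro Txi_precompose) auto
    finally show ?thesis .
  qed
  then show ?thesis unfolding VY_mu_def by (simp add: rcomp_def)
qed

lemma rcomp_under0_left_iff: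
  assumes "small X"
  shows "rel_le X Z (rcomp X \<psi> (under0 \<T> X a)) \<psi>
    \<longleftrightarrow> (\<forall>x\<in>X. \<forall>x'\<in>X. \<forall>z\<in>Z. a (e X x, x') * \<psi> (x', z) \<le> \<psi> (x, z))"
  using assms by (auto simp: rel_le_def rcomp_def SUP_le_iff under0_eq)

lemma rcomp_under0_right_iff:
  assumes "small Z"
  shows "rel_le X Z (rcomp Z (under0 \<T> Z c) \<psi>) \<psi>
    \<longleftrightarrow> (\<forall>x\<in>X. \<forall>z\<in>Z. \<forall>z'\<in>Z. \<psi> (x, z) * c (e Z z, z') \<le> \<psi> (x, z'))"
  using assms by (auto simp: rel_le_def rcomp_def SUP_le_iff under0_eq)

lemma rcomp_left_adjoint:
  assumes X: "tcat \<T> X a" and \<alpha>: "unit_left_adjoint \<T> X a \<alpha>"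
    and \<psi>: "\<And>x x'. x \<in> X \<Longrightarrow> x' \<in> X \<Longrightarrow> a (e X x, x') * \<psi> (x', z) \<le> \<psi> (x, z)" and x: "\<xx> \<in> T X"
  shows "rcomp X \<psi> a (\<xx>, z) = \<psi> (\<alpha> \<xx>, z)"
proof (rule antisym)
  have \<alpha>x: "\<alpha> \<xx> \<in> X"
    using \<alpha> x by (auto simp: unit_left_adjoint_def adjunction_def tfunctor_def)
  note struct = representable_structure[OF X \<alpha> x]
  show "rcomp X \<psi> a (\<xx>, z) \<le> \<psi> (\<alpha> \<xx>, z)"
    using \<psi> \<alpha>x by (intro rcomp_least) (simp add: struct)
  have "\<psi> (\<alpha> \<xx>, z) \<le> a (\<xx>, \<alpha> \<xx>) * \<psi> (\<alpha> \<xx>, z)"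
    using tcat_refl[OF X \<alpha>x] struct[OF \<alpha>x] by (intro one_le_mult) simp
  also have "\<dots> \<le> rcomp X \<psi> a (\<xx>, z)" using \<alpha>x by (rule rcomp_upper)
  finally show "\<psi> (\<alpha> \<xx>, z) \<le> rcomp X \<psi> a (\<xx>, z)" .
qed

lemma pseudo_hom_VY_iff:
  assumes r: "r \<in> X \<rightarrow> W" and X: "small X"
  shows "pseudo_hom \<T> X a W d r \<longleftrightarrow> tfunctor \<T> X a W d r \<and>
    (\<exists>\<alpha>. unit_left_adjoint \<T> X a \<alpha> \<and> (\<forall>\<xx>\<in>T X. \<forall>y\<in>Y. \<mu> (Tmap \<T> X W r \<xx>, y) = ev (r (\<alpha> \<xx>), y)))"
proof -
  have "map_equiv \<T> (T X) W d (\<gamma> \<circ> Tmap \<T> X W r) (r \<circ> \<alpha>)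
      \<longleftrightarrow> (\<forall>\<xx>\<in>T X. \<forall>y\<in>Y. \<mu> (Tmap \<T> X W r \<xx>, y) = ev (r (\<alpha> \<xx>), y))"
    if \<alpha>: "unit_left_adjoint \<T> X a \<alpha>" and \<gamma>: "unit_left_adjoint \<T> W d \<gamma>" for \<alpha> \<gamma>
  proof -
    have \<alpha>_in: "\<alpha> \<in> T X \<rightarrow> X" and \<gamma>_in: "\<gamma> \<in> T W \<rightarrow> W"
      using \<alpha> \<gamma> by (simp_all add: unit_left_adjoint_def adjunction_def tfunctor_def)
    have Tr: "Tmap \<T> X W r \<xx> \<in> T W" if "\<xx> \<in> T X" for \<xx> using r X that by simp
    have r\<alpha>: "r (\<alpha> \<xx>) \<in> W" if "\<xx> \<in> T X" for \<xx> using r \<alpha>_in that by auto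
    have "map_equiv \<T> (T X) W d (\<gamma> \<circ> Tmap \<T> X W r) (r \<circ> \<alpha>) \<longleftrightarrow> (\<forall>\<xx>\<in>T X. M (Tmap \<T> X W r \<xx>) = r (\<alpha> \<xx>))"
      using Tr r\<alpha> M_in left_adjoint_VY_unique[OF \<gamma>] by (subst map_equiv_VY_iff) auto
    also have "\<dots> \<longleftrightarrow> (\<forall>\<xx>\<in>T X. \<forall>y\<in>Y. ev (M (Tmap \<T> X W r \<xx>), y) = ev (r (\<alpha> \<xx>), y))"
      using M_in[OF Tr] r\<alpha> by (intro ball_cong refl iffI ballI) (simp, rule VY_eqI[OF small_Y], auto)
    finally show ?thesis by (simp add: ev_M)
  qed
  then show ?thesis unfolding pseudo_hom_def using left_adjoint_VY by blast
qed

lemma pseudo_hom_imp_distributor: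
  assumes X: "tcat \<T> X a" and r: "r \<in> X \<rightarrow> W" and hom: "pseudo_hom \<T> X a W d r"
    and \<psi>: "\<And>x y. x \<in> X \<Longrightarrow> y \<in> Y \<Longrightarrow> \<psi> (x, y) = ev (r x, y)"
  shows "rel_le X Y (rcomp X \<psi> (under0 \<T> X a)) \<psi>" (is ?left)
    and "rel_le X Y (rcomp Y (under0 \<T> Y b) \<psi>) \<psi>" (is ?right)
    and "rel_eq (T X) Y (rcomp X \<psi> a) (rcomp (T Y) b (Txi \<T> X Y \<psi>))" (is ?eq)
proof -
  have sm: "small X" using X by (rule tcat_small)
  obtain \<alpha> where r_functor: "tfunctor \<T> X a W d r" and \<alpha>: "unit_left_adjoint \<T> X a \<alpha>"
    and pseudo: "\<And>\<xx> y. \<xx> \<in> T X \<Longrightarrow> y \<in> Y \<Longrightarrow> \<mu> (Tmap \<T> X W r \<xx>, y) = ev (r (\<alpha> \<xx>), y)"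
    using hom by (auto simp: pseudo_hom_VY_iff[OF r sm])
  have left: "a (e X x, x') * \<psi> (x', y) \<le> \<psi> (x, y)" if x: "x \<in> X" "x' \<in> X" and y: "y \<in> Y" for x x' y
  proof -
    have "a (e X x, x') \<le> d (Tmap \<T> X W r (e X x), r x')"
      using r_functor x sm by (simp add: tfunctor_def)
    also have "Tmap \<T> X W r (e X x) = e W (r x)" using sm r x by (simp add: unit_natural)
    finally show ?thesis using x y funcset_mem[OF r x(1)] by (simp add: le_VY_struct_iff mu_unit \<psi>)
  qed
  then show ?left by (simp add: rcomp_under0_left_iff sm)
  have "ev (r x, y) * b (e Y y, y') \<le> ev (r x, y')" if "x \<in> X" "y \<in> Y" "y' \<in> Y" for x y y'
  proof -
    have "presheaf Y b (\<lambda>y. ev (r x, y))" using that r by (intro ev_presheaf) auto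
    then have "b (e Y y, y') * xiT \<T> Y (\<lambda>y. ev (r x, y)) (e Y y) \<le> ev (r x, y')"
      using that by (simp add: presheaf_def)
    then show ?thesis using that by (simp add: xiT_unit mult.commute)
  qed
  then show ?right by (simp add: rcomp_under0_right_iff \<psi>)
  show ?eq
    unfolding rel_eq_def
  proof (intro ballI)
    fix \<xx> y assume x: "\<xx> \<in> T X" and y: "y \<in> Y"
    have "\<alpha> \<xx> \<in> X" using \<alpha> x by (auto simp: unit_left_adjoint_def adjunction_def tfunctor_def)
    then have "rcomp X \<psi> a (\<xx>, y) = ev (r (\<alpha> \<xx>), y)"
      using rcomp_left_adjoint[OF X \<alpha> left[OF _ _ y] x] y by (simp add: \<psi>)
    also have "\<dots> = \<mu> (Tmap \<T> X W r \<xx>, y)" using pseudo x y by simp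
    also have "\<dots> = rcomp (T Y) b (Txi \<T> X Y \<psi>) (\<xx>, y)" using sm r x \<psi> by (rule mu_Tmap)
    finally show "rcomp X \<psi> a (\<xx>, y) = rcomp (T Y) b (Txi \<T> X Y \<psi>) (\<xx>, y)" .
  qed
qed

text \<open>
  The equation \<open>\<psi> \<cdot> a = b \<cdot> T\<^sub>\<xi> \<psi>\<close> is used three times.  At \<open>e x\<close> it makes \<open>\<psi> (x, -)\<close> a presheaf;
  in the form \<open>\<psi> \<cdot> a \<le> \<mu> \<cdot> T r\<close> it makes \<open>x \<mapsto> \<psi> (x, -)\<close> a functor; and, since \<open>\<psi> \<cdot> a = \<psi> \<cdot> \<alpha>\<close>, it
  says that this functor is a pseudo-homomorphism.
\<close>

lemma distributor_imp_pseudo_hom: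
  assumes X: "tcat \<T> X a" and \<alpha>: "unit_left_adjoint \<T> X a \<alpha>"
    and left: "rel_le X Y (rcomp X \<psi> (under0 \<T> X a)) \<psi>"
    and eq: "rel_eq (T X) Y (rcomp X \<psi> a) (rcomp (T Y) b (Txi \<T> X Y \<psi>))"
    and r: "\<And>x. x \<in> X \<Longrightarrow> r x = code Y (\<lambda>y. \<psi> (x, y))"
  shows "r \<in> X \<rightarrow> W" and "pseudo_hom \<T> X a W d r"
proof -
  have sm: "small X" using X by (rule tcat_small)
  have \<alpha>_in: "\<alpha> \<in> T X \<rightarrow> X" using \<alpha> by (simp add: unit_left_adjoint_def adjunction_def tfunctor_def)
  have left: "a (e X x, x') * \<psi> (x', y) \<le> \<psi> (x, y)" if "x \<in> X" "x' \<in> X" "y \<in> Y" for x x' y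
    using left that by (simp add: rcomp_under0_left_iff sm)
  have eq: "rcomp X \<psi> a (\<xx>, y) = rcomp (T Y) b (Txi \<T> X Y \<psi>) (\<xx>, y)" if "\<xx> \<in> T X" "y \<in> Y" for \<xx> y
    using eq that by (simp add: rel_eq_def)
  have presheaf: "presheaf Y b (\<lambda>y. \<psi> (x, y))" if x: "x \<in> X" for x
    unfolding presheaf_def
  proof (intro ballI)
    fix \<yy> z assume y: "\<yy> \<in> T Y" "z \<in> Y"
    have "b (\<yy>, z) * xiT \<T> Y (\<lambda>y. \<psi> (x, y)) \<yy> = Txi \<T> X Y \<psi> (e X x, \<yy>) * b (\<yy>, z)"
      using sm x y by (simp add: Txi_unit_left mult.commute)
    also have "\<dots> \<le> rcomp (T Y) b (Txi \<T> X Y \<psi>) (e X x, z)" using y by (intro rcomp_upper)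
    also have "\<dots> = rcomp X \<psi> a (e X x, z)" using sm x y by (simp add: eq)
    also have "\<dots> \<le> \<psi> (x, z)" using left x y by (intro rcomp_least)
    finally show "b (\<yy>, z) * xiT \<T> Y (\<lambda>y. \<psi> (x, y)) \<yy> \<le> \<psi> (x, z)" .
  qed
  then show r_in: "r \<in> X \<rightarrow> W" by (auto simp: r intro!: code_in_VY)
  have ev_r: "\<psi> (x, y) = ev (r x, y)" if "x \<in> X" "y \<in> Y" for x y
    using that by (simp add: r ev_code)
  have mu: "\<mu> (Tmap \<T> X W r \<xx>, y) = rcomp X \<psi> a (\<xx>, y)" if "\<xx> \<in> T X" "y \<in> Y" for \<xx> y
    using mu_Tmap[OF sm r_in that(1) ev_r] eq[OF that] by simp
  have "tfunctor \<T> X a W d r"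
    unfolding tfunctor_def
  proof (intro conjI ballI r_in)
    fix \<xx> x assume x: "\<xx> \<in> T X" "x \<in> X"
    show "a (\<xx>, x) \<le> d (Tmap \<T> X W r \<xx>, r x)"
      unfolding le_VY_struct_iff
    proof
      fix y assume y: "y \<in> Y"
      show "a (\<xx>, x) * ev (r x, y) \<le> \<mu> (Tmap \<T> X W r \<xx>, y)"
        using rcomp_upper[of x X a \<xx> \<psi> y] x y by (simp add: mu ev_r)
    qed
  qed
  moreover have "\<mu> (Tmap \<T> X W r \<xx>, y) = ev (r (\<alpha> \<xx>), y)" if "\<xx> \<in> T X" "y \<in> Y" for \<xx> y
    using rcomp_left_adjoint[OF X \<alpha> left[OF _ _ that(2)] that(1)] mu[OF that]
      ev_r[OF funcset_mem[OF \<alpha>_in that(1)] that(2)] by simp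
  ultimately show "pseudo_hom \<T> X a W d r"
    using \<alpha> by (auto simp: pseudo_hom_VY_iff[OF r_in sm])
qed

end

theorem proposition8p1:
  fixes \<T> :: "('u::set_universe, 'v::comm_quantale) top_theory"
    and X Y :: "'u set" and a b :: "('u, 'v) vrel"
  assumes "topological_theory \<T>"
    and "(bot::'v) \<noteq> 1"
    and "\<exists>t. Tob \<T> uone = {t}"
    and "representable \<T> X a"
    and "representable \<T> Y b"
  shows "bij_betw (lower \<T> X Y)
    (reprcat_hom \<T> X a (VY_set \<T> Y b) (VY_struct \<T> Y b))
    {\<psi> \<in> vdistributors X (under0 \<T> X a) Y (under0 \<T> Y b).
       rel_eq (Tob \<T> X) Y (rcomp X \<psi> a) (rcomp (Tob \<T> Y) b (Txi \<T> X Y \<psi>))}"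
    (is "bij_betw _ ?H ?D")
proof -
  obtain \<alpha> \<beta> where X: "tcat \<T> X a" and \<alpha>: "unit_left_adjoint \<T> X a \<alpha>"
    and Y: "tcat \<T> Y b" and \<beta>: "unit_left_adjoint \<T> Y b \<beta>"
    using assms(4,5) by (auto simp: representable_def)
  interpret presheaf_category \<T> Y b \<beta>
    using assms(1,3) Y \<beta> by unfold_locales
  define r where "r \<psi> = (\<lambda>x\<in>X. code Y (\<lambda>y. \<psi> (x, y)))" for \<psi> :: "('u, 'v) vrel"
  show ?thesis
  proof (rule bij_betwI[where g = r])
    show "lower \<T> X Y \<in> ?H \<rightarrow> ?D"
    proof
      fix f assume "f \<in> ?H"
      then have f: "f \<in> X \<rightarrow> W" "pseudo_hom \<T> X a W d f" by (auto simp: reprcat_hom_def)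
      have "lower \<T> X Y f \<in> X \<times> Y \<rightarrow>\<^sub>E UNIV"
        unfolding lower_def by (rule restrict_PiE_iff[THEN iffD2]) simp
      then show "lower \<T> X Y f \<in> ?D"
        using pseudo_hom_imp_distributor[OF X f, of "lower \<T> X Y f"]
        by (simp add: vdistributors_def lower_def)
    qed
    show "r \<in> ?D \<rightarrow> ?H"
    proof
      fix \<psi> assume "\<psi> \<in> ?D"
      then have "r \<psi> \<in> X \<rightarrow> W" "pseudo_hom \<T> X a W d (r \<psi>)"
        using distributor_imp_pseudo_hom[OF X \<alpha>, of \<psi> "r \<psi>"] by (auto simp: vdistributors_def r_def)
      then show "r \<psi> \<in> ?H"
        using assms(4) representable_VY by (simp add: reprcat_hom_def PiE_iff Pi_iff) (simp add: r_def)
    qed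
    show "r (lower \<T> X Y f) = f" if "f \<in> ?H" for f
    proof (rule ext)
      fix x
      have f: "f \<in> X \<rightarrow>\<^sub>E W" using that by (simp add: reprcat_hom_def)
      show "r (lower \<T> X Y f) x = f x"
      proof (cases "x \<in> X")
        case True
        then obtain g where g: "f x = code Y g" using f VY_set_iff[OF small_Y] by blast
        show ?thesis using True by (auto simp: r_def lower_def g ev_code intro!: code_cong)
      next
        case False
        then show ?thesis using PiE_arb[OF f False] by (simp add: r_def)
      qed
    qed
    show "lower \<T> X Y (r \<psi>) = \<psi>" if "\<psi> \<in> ?D" for \<psi>
    proof (rule ext)
      fix p
      have \<psi>: "\<psi> \<in> X \<times> Y \<rightarrow>\<^sub>E UNIV" using that by (simp add: vdistributors_def)
      show "lower \<T> X Y (r \<psi>) p = \<psi> p"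
      proof (cases "p \<in> X \<times> Y")
        case True
        then show ?thesis by (auto simp: lower_def r_def ev_code)
      next
        case False
        then show ?thesis using PiE_arb[OF \<psi> False] by (simp add: lower_def)
      qed
    qed
  qed
qed

end
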